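(* Consider the kinematic optimal control problem of minimizing $I=\int_a^b g(q,w)\,dt$ over curves with fixed endpoints $q(a),q(b)$ satisfying the constraints $u^\sigma=\Psi^\sigma_i\dot q^i=0$ ($\sigma=1,\dots,m$), with controls $w^I=u^I=\Psi^I_i\dot q^i$ ($I=m+1,\dots,n$), and let $C(q,u)=g(q,u)$ be the cost integrand in terms of quasi-velocities (it depends only on $q$ and on the unconstrained quasi-velocities $u^I$). Then the Boltzmann-Hamel equations for this problem, i.e. the necessary and sufficient conditions for a smooth curve $q(t)$ and smooth multipliers $\mu_1(t),\dots,\mu_m(t)$, $t\in[a,b]$, to be a stationary point of the augmented cost $$\int_a^b\bigl(C(q,u)+\mu_\sigma u^\sigma\bigr)\,dt$$ with respect to arbitrary smooth variations of $\mu$ and arbitrary smooth variations of $q$ (not required to satisfy the constraints) with fixed endpoints $q(a),q(b)$, are $$\frac{d}{dt}\frac{\partial C}{\partial u^I}-\frac{\partial C}{\partial\theta^I}-\frac{\partial C}{\partial u^J}\gamma^J_{SI}u^S=\mu_\tau\gamma^\tau_{SI}u^S,\qquad I=m+1,\dots,n,$$ $$-\frac{\partial C}{\partial\theta^\sigma}-\frac{\partial C}{\partial u^J}\gamma^J_{S\sigma}u^S=-\dot\mu_\sigma+\mu_\tau\gamma^\tau_{S\sigma}u^S,\qquad \sigma=1,\dots,m,$$ $$\dot q^i=\Phi^i_Su^S,\qquad i=1,\dots,n.$$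
   Context: Index and summation convention: repeated indices are summed; Greek indices ($\sigma,\tau,\dots$) run over $1,\dots,m$ (constrained directions), capital Latin indices ($I,J,S,\dots$) over $m+1,\dots,n$ (unconstrained directions), lower-case Latin indices over $1,\dots,n$. All functions are smooth. Setting: $Q$ is an $n$-dimensional configuration manifold with local coordinates $q=(q^1,\dots,q^n)$; curves are considered in such a coordinate domain. The system is subject to $m$ linear time-independent nonholonomic constraints $a^\sigma_i(q)\dot q^i=0$. $\Psi(q)=(\Psi^j_i(q))$ is an invertible $n\times n$ matrix depending smoothly on $q$, with first $m$ rows $\Psi^\sigma_i=a^\sigma_i$ and remaining rows chosen so that $w^I=\Psi^I_i\dot q^i$ are the controls; $\Phi(q)=(\Phi^i_j(q))$ is the inverse matrix of $\Psi(q)$. Equivalently, the control system is $\dot q^i=X^i_I(q)w^I$ with $X^i_I=\Phi^i_I$. Quasi-velocities: along a curve $q(t)$, $u^j=\Psi^j_i(q)\dot q^i$, so $\dot q^i=\Phi^i_ju^j$ and the constraints read $u^\sigma=0$. Quasi-basis derivatives: for a function $C(q,u)$, $\dfrac{\partial C}{\partial\theta^i}=\Phi^j_i\dfrac{\partial C}{\partial q^j}$, where $\partial/\partial q^j$ is taken with $u$ held fixed. Hamel coefficients: $\gamma^s_{pq}=\left(\dfrac{\partial\Psi^s_i}{\partial q^j}-\dfrac{\partial\Psi^s_j}{\partial q^i}\right)\Phi^i_p\Phi^j_q$ (here $p,q,s$ are indices in $1,\dots,n$). Variations: a variation of a curve $q(t)$ with fixed endpoints is a smooth family $q(s,t)$,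 $s\in[-\varepsilon,\varepsilon]$, $t\in[a,b]$, with $q(0,t)=q(t)$, $q(s,a)=q(a)$, $q(s,b)=q(b)$; variations of $\mu$ are smooth families $\mu(s,t)$ with $\mu(0,t)=\mu(t)$. Stationary means that the derivative with respect to $s$ at $s=0$ of the functional vanishes for all such variations. *)

theory Defs
  imports "HOL-Analysis.Analysis"
begin

section \<open>Smooth maps\<close>

primrec Ck_on_open ::
  "nat \<Rightarrow> 'a::real_normed_vector set \<Rightarrow> ('a \<Rightarrow> 'b::real_normed_vector) \<Rightarrow> bool" where
  "Ck_on_open 0 U f \<longleftrightarrow> continuous_on U f"
| "Ck_on_open (Suc k) U f \<longleftrightarrow>
     (\<forall>x\<in>U. f differentiable (at x)) \<and>
     (\<forall>v. Ck_on_open k U (\<lambda>x. frechet_derivative f (at x) v))"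

text \<open>
  On a set that need not be open, smooth means: restriction of a smooth map on some open
  neighbourhood. For open \<open>S\<close> this is the usual notion.
\<close>

definition smooth_on ::
  "'a::real_normed_vector set \<Rightarrow> ('a \<Rightarrow> 'b::real_normed_vector) \<Rightarrow> bool" where
  "smooth_on S f \<longleftrightarrow>
     (\<exists>U F. open U \<and> S \<subseteq> U \<and> (\<forall>k. Ck_on_open k U F) \<and> (\<forall>x\<in>S. F x = f x))"

definition partial_deriv ::
  "(real^'n::finite \<Rightarrow> 'b::real_normed_vector) \<Rightarrow> 'n \<Rightarrow> real^'n \<Rightarrow> 'b" where
  "partial_deriv f j x = vector_derivative (\<lambda>h. f (x + h *\<^sub>R axis j 1)) (at 0)"


section \<open>Quasi-velocities and Hamel coefficients\<close>

text \<open>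
  Coordinates are indexed by \<open>'m + 'k\<close>: the indices \<open>Inl \<sigma>\<close> are the \<open>m = CARD('m)\<close> constrained
  directions and the indices \<open>Inr I\<close> the \<open>n - m = CARD('k)\<close> unconstrained ones.
  For a matrix \<open>A\<close>, the entry with upper index \<open>i\<close> and lower index \<open>j\<close> is \<open>A $ i $ j\<close>; thus row
  \<open>Inl \<sigma>\<close> of \<open>\<Psi> x\<close> is the constraint covector \<open>a\<^sup>\<sigma>(x)\<close>, and row \<open>Inr I\<close> defines the control \<open>w\<^sup>I\<close>.
  \<open>\<Phi> x\<close> is \<open>matrix_inv (\<Psi> x)\<close>.

  All time derivatives are taken within \<open>{a..b}\<close>, so they are one-sided at the endpoints and do
  not depend on values outside the interval.
\<close>

definition quasi_velocity ::
  "(real^'n \<Rightarrow> real^'n^'n::finite) \<Rightarrow> real \<Rightarrow> real \<Rightarrow> (real \<Rightarrow> real^'n) \<Rightarrow> real \<Rightarrow> real^'n" where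
  "quasi_velocity \<Psi> a b q t = \<Psi> (q t) *v vector_derivative q (at t within {a..b})"

definition theta_deriv ::
  "(real^'n \<Rightarrow> real^'n^'n::finite) \<Rightarrow> (real^'n \<Rightarrow> real^'n \<Rightarrow> real) \<Rightarrow> 'n \<Rightarrow> real^'n \<Rightarrow> real^'n \<Rightarrow> real" where
  "theta_deriv \<Psi> C i x u =
     (\<Sum>j\<in>UNIV. matrix_inv (\<Psi> x) $ j $ i * partial_deriv (\<lambda>y. C y u) j x)"

definition u_deriv ::
  "(real^'n \<Rightarrow> real^'n \<Rightarrow> real) \<Rightarrow> 'n::finite \<Rightarrow> real^'n \<Rightarrow> real^'n \<Rightarrow> real" where
  "u_deriv C j x u = partial_deriv (\<lambda>v. C x v) j u"

text \<open>\<open>hamel \<Psi> x s p q\<close> is the coefficient with upper index \<open>s\<close> and lower indices \<open>p\<close>, \<open>q\<close>.\<close>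

definition hamel ::
  "(real^'n \<Rightarrow> real^'n^'n::finite) \<Rightarrow> real^'n \<Rightarrow> 'n \<Rightarrow> 'n \<Rightarrow> 'n \<Rightarrow> real" where
  "hamel \<Psi> x s p q =
     (\<Sum>i\<in>UNIV. \<Sum>j\<in>UNIV.
        (partial_deriv (\<lambda>y. \<Psi> y $ s $ i) j x - partial_deriv (\<lambda>y. \<Psi> y $ s $ j) i x)
        * matrix_inv (\<Psi> x) $ i $ p * matrix_inv (\<Psi> x) $ j $ q)"


section \<open>The augmented cost and its stationary points\<close>

definition cost_of_quasi_velocity ::
  "(real^('m + 'k) \<Rightarrow> real^'k \<Rightarrow> real) \<Rightarrow> real^('m::finite + 'k::finite) \<Rightarrow> real^('m + 'k) \<Rightarrow> real" where
  "cost_of_quasi_velocity g x u = g x (\<chi> I. u $ Inr I)"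

definition augmented_cost ::
  "(real^('m + 'k) \<Rightarrow> real^('m + 'k)^('m::finite + 'k::finite)) \<Rightarrow>
   (real^('m + 'k) \<Rightarrow> real^('m + 'k) \<Rightarrow> real) \<Rightarrow> real \<Rightarrow> real \<Rightarrow>
   (real \<Rightarrow> real^('m + 'k)) \<Rightarrow> (real \<Rightarrow> real^'m) \<Rightarrow> real" where
  "augmented_cost \<Psi> C a b q \<mu> =
     integral {a..b} (\<lambda>t. C (q t) (quasi_velocity \<Psi> a b q t)
       + (\<Sum>\<sigma>\<in>UNIV. \<mu> t $ \<sigma> * quasi_velocity \<Psi> a b q t $ Inl \<sigma>))"

definition smooth_variation ::
  "real \<Rightarrow> real \<Rightarrow> real \<Rightarrow> (real \<Rightarrow> 'a::real_normed_vector) \<Rightarrow> (real \<Rightarrow> real \<Rightarrow> 'a) \<Rightarrow> bool" where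
  "smooth_variation \<epsilon> a b c V \<longleftrightarrow>
     smooth_on ({-\<epsilon>..\<epsilon>} \<times> {a..b}) (\<lambda>(s, t). V s t) \<and> (\<forall>t\<in>{a..b}. V 0 t = c t)"

definition fixed_endpoint_variation ::
  "'a::real_normed_vector set \<Rightarrow> real \<Rightarrow> real \<Rightarrow> real \<Rightarrow> (real \<Rightarrow> 'a) \<Rightarrow> (real \<Rightarrow> real \<Rightarrow> 'a) \<Rightarrow> bool" where
  "fixed_endpoint_variation D \<epsilon> a b q V \<longleftrightarrow>
     smooth_variation \<epsilon> a b q V \<and>
     (\<forall>s\<in>{-\<epsilon>..\<epsilon>}. \<forall>t\<in>{a..b}. V s t \<in> D) \<and>
     (\<forall>s\<in>{-\<epsilon>..\<epsilon>}. V s a = q a \<and> V s b = q b)"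

definition stationary_augmented_cost ::
  "(real^('m + 'k)) set \<Rightarrow> (real^('m + 'k) \<Rightarrow> real^('m + 'k)^('m::finite + 'k::finite)) \<Rightarrow>
   (real^('m + 'k) \<Rightarrow> real^('m + 'k) \<Rightarrow> real) \<Rightarrow> real \<Rightarrow> real \<Rightarrow>
   (real \<Rightarrow> real^('m + 'k)) \<Rightarrow> (real \<Rightarrow> real^'m) \<Rightarrow> bool" where
  "stationary_augmented_cost D \<Psi> C a b q \<mu> \<longleftrightarrow>
     (\<forall>\<epsilon>>0. \<forall>V M.
        fixed_endpoint_variation D \<epsilon> a b q V \<longrightarrow> smooth_variation \<epsilon> a b \<mu> M \<longrightarrow>
        ((\<lambda>s. augmented_cost \<Psi> C a b (V s) (M s)) has_real_derivative 0) (at 0))"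

end

theory Submission
  imports Defs
begin

text \<open>
  In terms of the Lagrangian \<open>L(q, v, \<mu>) = C(q, \<Psi> v) + \<mu>\<^sub>\<sigma> (\<Psi> v)\<^sup>\<sigma>\<close> the augmented cost is the action
  \<open>\<integral> L(q, q', \<mu>) dt\<close>, where \<open>q\<close> varies with fixed endpoints and \<open>\<mu>\<close> varies freely.
  Hence stationarity means that the Euler-Lagrange expressions \<open>\<partial>L/\<partial>q\<^sup>i - d/dt \<partial>L/\<partial>v\<^sup>i\<close> vanish along
  the curve and that \<open>\<partial>L/\<partial>\<mu>\<^sub>\<sigma> = u\<^sup>\<sigma> = 0\<close>. Since \<open>\<partial>L/\<partial>v\<^sup>i = p\<^sub>s \<Psi>\<^sup>s\<^sub>i\<close> with quasi-momenta
  \<open>p\<^sub>\<sigma> = \<mu>\<^sub>\<sigma>\<close> and \<open>p\<^sub>I = \<partial>C/\<partial>u\<^sup>I\<close>, contracting the Euler-Lagrange expressions with the invertible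
  matrix \<open>\<Phi>\<close> gives \<open>\<partial>C/\<partial>\<theta>\<^sup>r + p\<^sub>s \<gamma>\<^sup>s\<^sub>k\<^sub>r u\<^sup>k - dp\<^sub>r/dt\<close>; the two families \<open>r = I\<close> and \<open>r = \<sigma>\<close>
  are the Boltzmann-Hamel equations.
\<close>

section \<open>Calculus of smooth maps\<close>

text \<open>On an open set, derivatives see only the values inside, so agreement passes to all
  orders. The rules below use this to replace the derivative of a sum, product or composite by its
  explicit formula before the induction hypothesis is applied.\<close>

lemma Ck_on_open_cong:
  assumes "open U" "\<And>x. x \<in> U \<Longrightarrow> f x = g x" "Ck_on_open k U f"
  shows "Ck_on_open k U g"
  using assms(2,3)
proof (induction k arbitrary: f g)
  case 0
  then show ?case by (simp cong: continuous_on_cong)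
next
  case (Suc k)
  have *: "frechet_derivative f (at x) = frechet_derivative g (at x)" if "x \<in> U" for x
    using Suc.prems that \<open>open U\<close> by (auto intro: frechet_derivative_transform_within_open)
  have "g differentiable (at x)" if "x \<in> U" for x
    using Suc.prems that \<open>open U\<close> unfolding differentiable_def
    by (metis Ck_on_open.simps(2) differentiable_def has_derivative_transform_within_open)
  moreover have "Ck_on_open k U (\<lambda>x. frechet_derivative g (at x) v)" for v
    by (rule Suc.IH[of "\<lambda>x. frechet_derivative f (at x) v"]) (use Suc.prems * in auto)
  ultimately show ?case by simp
qed

lemma Ck_on_open_subset: "Ck_on_open k U f \<Longrightarrow> V \<subseteq> U \<Longrightarrow> Ck_on_open k V f"
  by (induction k arbitrary: f) (auto intro: continuous_on_subset)

lemma Ck_on_open_Suc_imp: "Ck_on_open (Suc k) U f \<Longrightarrow> Ck_on_open k U f"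
proof (induction k arbitrary: f)
  case 0
  then show ?case
    by (simp add: continuous_at_imp_continuous_on differentiable_imp_continuous_within)
qed simp

lemma Ck_on_open_const: "Ck_on_open k U (\<lambda>x. c)"
  by (induction k arbitrary: c) auto

lemma Ck_on_open_linear:
  assumes "bounded_linear f"
  shows "Ck_on_open k U f"
proof -
  have "frechet_derivative f (at x) = f" for x
    by (rule frechet_derivative_at[symmetric]) (rule bounded_linear_imp_has_derivative[OF assms])
  then show ?thesis
    using assms
    by (cases k)
       (simp_all add: linear_continuous_on Ck_on_open_const bounded_linear_imp_differentiable)
qed

lemma Ck_on_open_add:
  assumes "open U" "Ck_on_open k U f" "Ck_on_open k U g"
  shows "Ck_on_open k U (\<lambda>x. f x + g x)"
  using assms(2,3)
proof (induction k arbitrary: f g)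
  case 0
  then show ?case by (auto intro: continuous_intros)
next
  case (Suc k)
  have *: "frechet_derivative (\<lambda>x. f x + g x) (at x) v
      = frechet_derivative f (at x) v + frechet_derivative g (at x) v" if "x \<in> U" for x v
    using Suc.prems that
    by (subst frechet_derivative_at[OF has_derivative_add, symmetric])
       (auto simp: frechet_derivative_works)
  have "Ck_on_open k U (\<lambda>x. frechet_derivative (\<lambda>x. f x + g x) (at x) v)" for v
    by (rule Ck_on_open_cong[OF \<open>open U\<close> *[symmetric]]) (use Suc in auto)
  then show ?case using Suc.prems by auto
qed

text \<open>Induction by the Leibniz rule: both terms of the derivative are again products of
  \<open>k\<close> times differentiable maps. The bilinear form covers real products, scaling and
  \<open>\<Psi>(q) v\<close> at once.\<close>

lemma (in bounded_bilinear) Ck_on_open: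
  assumes "open U" "Ck_on_open k U f" "Ck_on_open k U g"
  shows "Ck_on_open k U (\<lambda>x. prod (f x) (g x))"
  using assms(2,3)
proof (induction k arbitrary: f g)
  case 0
  then show ?case by (auto intro: continuous_on)
next
  case (Suc k)
  have D: "((\<lambda>x. prod (f x) (g x)) has_derivative
      (\<lambda>v. prod (f x) (frechet_derivative g (at x) v) + prod (frechet_derivative f (at x) v) (g x))) (at x)"
    if "x \<in> U" for x
    using Suc.prems that by (intro FDERIV) (auto simp: frechet_derivative_works)
  have *: "frechet_derivative (\<lambda>x. prod (f x) (g x)) (at x) v
      = prod (f x) (frechet_derivative g (at x) v) + prod (frechet_derivative f (at x) v) (g x)"
    if "x \<in> U" for x v
    by (simp add: frechet_derivative_at[OF D[OF that], symmetric])
  have "Ck_on_open k U f" "Ck_on_open k U g"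
    using Suc.prems Ck_on_open_Suc_imp by auto
  then have "Ck_on_open k U (\<lambda>x. frechet_derivative (\<lambda>x. prod (f x) (g x)) (at x) v)" for v
    by (intro Ck_on_open_cong[OF \<open>open U\<close> *[symmetric]] Ck_on_open_add Suc.IH \<open>open U\<close>)
       (use Suc.prems in auto)
  then show ?case using D by (auto simp: differentiable_def)
qed

text \<open>A fixed linear outer map commutes with differentiation, so the intermediate space may
  have any dimension. The general composition rule below relies on this case.\<close>

lemma Ck_on_open_linear_compose:
  assumes "open U" "bounded_linear h" "Ck_on_open k U f"
  shows "Ck_on_open k U (\<lambda>x. h (f x))"
  using assms(3)
proof (induction k arbitrary: f)
  case 0
  then show ?case by (simp add: bounded_linear.continuous_on[OF assms(2)])
next
  case (Suc k)
  have D: "((\<lambda>x. h (f x)) has_derivative (\<lambda>v. h (frechet_derivative f (at x) v))) (at x)"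
    if "x \<in> U" for x
    using Suc.prems that
    by (intro bounded_linear.has_derivative[OF assms(2)]) (auto simp: frechet_derivative_works)
  have *: "frechet_derivative (\<lambda>x. h (f x)) (at x) v = h (frechet_derivative f (at x) v)"
    if "x \<in> U" for x v
    by (simp add: frechet_derivative_at[OF D[OF that], symmetric])
  have "Ck_on_open k U (\<lambda>x. frechet_derivative (\<lambda>x. h (f x)) (at x) v)" for v
    by (rule Ck_on_open_cong[OF \<open>open U\<close> *[symmetric]]) (use Suc in auto)
  then show ?case using D by (auto simp: differentiable_def)
qed

lemma Ck_on_open_sum:
  assumes "open U" "finite A" "\<And>i. i \<in> A \<Longrightarrow> Ck_on_open k U (f i)"
  shows "Ck_on_open k U (\<lambda>x. \<Sum>i\<in>A. f i x)"
  using assms(2,3)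
  by (induction A rule: finite_induct) (auto intro: Ck_on_open_const Ck_on_open_add \<open>open U\<close>)

lemma linear_Basis_expansion:
  fixes h :: "'a::euclidean_space \<Rightarrow> 'b::real_vector"
  assumes "linear h"
  shows "h v = (\<Sum>b\<in>Basis. (v \<bullet> b) *\<^sub>R h b)"
proof -
  have "h v = h (\<Sum>b\<in>Basis. (v \<bullet> b) *\<^sub>R b)"
    by (simp add: euclidean_representation)
  also have "\<dots> = (\<Sum>b\<in>Basis. (v \<bullet> b) *\<^sub>R h b)"
    by (simp add: linear_sum[OF assms] linear_scale[OF assms])
  finally show ?thesis .
qed

text \<open>
  The derivative of the inner map varies with the point, so the derivative of the outer map is
  expanded in a basis; this is where the intermediate space has to be finite-dimensional.
\<close>

lemma Ck_on_open_compose: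
  fixes f :: "'b::euclidean_space \<Rightarrow> 'c::real_normed_vector"
    and g :: "'a::real_normed_vector \<Rightarrow> 'b"
  assumes "open U" "open V" "g ` U \<subseteq> V" "Ck_on_open k V f" "Ck_on_open k U g"
  shows "Ck_on_open k U (\<lambda>x. f (g x))"
  using assms(4,5)
proof (induction k arbitrary: f)
  case 0
  then show ?case using assms(3) by (auto intro: continuous_on_compose2)
next
  case (Suc k)
  have D: "((\<lambda>x. f (g x)) has_derivative
      (\<lambda>v. frechet_derivative f (at (g x)) (frechet_derivative g (at x) v))) (at x)"
    if "x \<in> U" for x
    using has_derivative_compose[of g "frechet_derivative g (at x)" x UNIV f] Suc.prems that assms(3)
    by (auto simp: frechet_derivative_works)
  have *: "frechet_derivative (\<lambda>x. f (g x)) (at x) v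
      = (\<Sum>b\<in>Basis. (frechet_derivative g (at x) v \<bullet> b) *\<^sub>R frechet_derivative f (at (g x)) b)"
    if "x \<in> U" for x v
  proof -
    have "linear (frechet_derivative f (at (g x)))"
      using Suc.prems that assms(3) by (auto intro!: linear_frechet_derivative)
    then show ?thesis
      by (simp add: frechet_derivative_at[OF D[OF that], symmetric] linear_Basis_expansion[symmetric])
  qed
  have g: "Ck_on_open k U g"
    using Suc.prems Ck_on_open_Suc_imp by auto
  have "Ck_on_open k U (\<lambda>x. frechet_derivative (\<lambda>x. f (g x)) (at x) v)" for v
    by (intro Ck_on_open_cong[OF \<open>open U\<close> *[symmetric]] Ck_on_open_sum \<open>open U\<close>
          bounded_bilinear.Ck_on_open[OF bounded_bilinear_scaleR]
          Ck_on_open_linear_compose[OF _ bounded_linear_inner_left] Suc.IH g)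
       (use Suc.prems in auto)
  then show ?case using D by (auto simp: differentiable_def)
qed

section \<open>Smoothness on arbitrary sets through open extensions\<close>

lemma smooth_on_cong: "smooth_on S f \<Longrightarrow> (\<And>x. x \<in> S \<Longrightarrow> f x = g x) \<Longrightarrow> smooth_on S g"
  unfolding smooth_on_def by metis

lemma smooth_on_open_iff:
  assumes "open S"
  shows "smooth_on S f \<longleftrightarrow> (\<forall>k. Ck_on_open k S f)"
proof
  assume "smooth_on S f"
  then obtain U F where "open U" "S \<subseteq> U" "\<And>k. Ck_on_open k U F" "\<And>x. x \<in> S \<Longrightarrow> F x = f x"
    unfolding smooth_on_def by blast
  then show "\<forall>k. Ck_on_open k S f"
    by (intro allI Ck_on_open_cong[OF assms _ Ck_on_open_subset[of _ U F]]) auto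
qed (use assms smooth_on_def in blast)

lemma smooth_on_subset: "smooth_on S f \<Longrightarrow> T \<subseteq> S \<Longrightarrow> smooth_on T f"
  unfolding smooth_on_def by (elim exE conjE, intro exI conjI) (assumption | blast)+

lemma smooth_on_extension:
  assumes "smooth_on S f"
  obtains U F where "open U" "S \<subseteq> U" "smooth_on U F" "\<And>x. x \<in> S \<Longrightarrow> F x = f x"
proof -
  obtain U F where "open U" "S \<subseteq> U" "\<And>k. Ck_on_open k U F" "\<And>x. x \<in> S \<Longrightarrow> F x = f x"
    using assms unfolding smooth_on_def by blast
  then show ?thesis using that smooth_on_open_iff by blast
qed

lemma smooth_on_const: "smooth_on S (\<lambda>x. c)"
  unfolding smooth_on_def using Ck_on_open_const open_UNIV by blast

lemma smooth_on_linear: "bounded_linear f \<Longrightarrow> smooth_on S f"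
  unfolding smooth_on_def using Ck_on_open_linear open_UNIV by blast

lemma smooth_on_add:
  assumes "smooth_on S f" "smooth_on S g"
  shows "smooth_on S (\<lambda>x. f x + g x)"
proof -
  obtain U F where F: "open U" "S \<subseteq> U" "\<And>k. Ck_on_open k U F" "\<And>x. x \<in> S \<Longrightarrow> F x = f x"
    using assms(1) unfolding smooth_on_def by blast
  obtain V G where G: "open V" "S \<subseteq> V" "\<And>k. Ck_on_open k V G" "\<And>x. x \<in> S \<Longrightarrow> G x = g x"
    using assms(2) unfolding smooth_on_def by blast
  have "Ck_on_open k (U \<inter> V) (\<lambda>x. F x + G x)" for k
    using F(1,3) G(1,3) by (intro Ck_on_open_add) (blast intro: Ck_on_open_subset)+
  then show ?thesis
    unfolding smooth_on_def using F G
    by (intro exI[of _ "U \<inter> V"] exI[of _ "\<lambda>x. F x + G x"]) auto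
qed

lemma (in bounded_bilinear) smooth_on:
  assumes "smooth_on S f" "smooth_on S g"
  shows "smooth_on S (\<lambda>x. prod (f x) (g x))"
proof -
  obtain U F where F: "open U" "S \<subseteq> U" "\<And>k. Ck_on_open k U F" "\<And>x. x \<in> S \<Longrightarrow> F x = f x"
    using assms(1) unfolding smooth_on_def by blast
  obtain V G where G: "open V" "S \<subseteq> V" "\<And>k. Ck_on_open k V G" "\<And>x. x \<in> S \<Longrightarrow> G x = g x"
    using assms(2) unfolding smooth_on_def by blast
  have "Ck_on_open k (U \<inter> V) (\<lambda>x. prod (F x) (G x))" for k
    using F(1,3) G(1,3) by (intro Ck_on_open) (blast intro: Ck_on_open_subset)+
  then show ?thesis
    unfolding smooth_on_def using F G
    by (intro exI[of _ "U \<inter> V"] exI[of _ "\<lambda>x. prod (F x) (G x)"]) auto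
qed

lemmas smooth_on_scaleR = bounded_bilinear.smooth_on[OF bounded_bilinear_scaleR]
lemmas smooth_on_mult = bounded_bilinear.smooth_on[OF bounded_bilinear_mult]

lemma smooth_on_linear_compose:
  assumes "bounded_linear h" "smooth_on S f"
  shows "smooth_on S (\<lambda>x. h (f x))"
proof -
  obtain U F where F: "open U" "S \<subseteq> U" "\<And>k. Ck_on_open k U F" "\<And>x. x \<in> S \<Longrightarrow> F x = f x"
    using assms(2) unfolding smooth_on_def by blast
  then show ?thesis
    unfolding smooth_on_def using Ck_on_open_linear_compose[OF F(1) assms(1) F(3)]
    by (intro exI[of _ U] exI[of _ "\<lambda>x. h (F x)"]) simp
qed

lemma smooth_on_sum:
  "finite A \<Longrightarrow> (\<And>i. i \<in> A \<Longrightarrow> smooth_on S (f i)) \<Longrightarrow> smooth_on S (\<lambda>x. \<Sum>i\<in>A. f i x)"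
  by (induction A rule: finite_induct) (auto intro: smooth_on_const smooth_on_add)

lemma smooth_on_Pair:
  assumes "smooth_on S f" "smooth_on S g"
  shows "smooth_on S (\<lambda>x. (f x, g x))"
proof -
  \<comment> \<open>A pair is a sum of two linear images, which reduces pairing to rules already
    available.\<close>
  have "smooth_on S (\<lambda>x. (f x, 0) + (0, g x))"
    by (intro smooth_on_add smooth_on_linear_compose[where h = "\<lambda>y. (y, 0)"]
        smooth_on_linear_compose[where h = "Pair 0"] assms
        bounded_linear_Pair bounded_linear_ident bounded_linear_zero)
  then show ?thesis by simp
qed

lemma smooth_on_continuous_on:
  assumes "smooth_on S f"
  shows "continuous_on S f"
proof -
  obtain U F where F: "S \<subseteq> U" "Ck_on_open 0 U F" "\<And>x. x \<in> S \<Longrightarrow> F x = f x"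
    using assms unfolding smooth_on_def by metis
  then have "continuous_on S F" by (metis Ck_on_open.simps(1) continuous_on_subset)
  then show ?thesis by (rule continuous_on_eq) (rule F(3))
qed

lemma smooth_on_compose:
  fixes f :: "'b::euclidean_space \<Rightarrow> 'c::real_normed_vector"
    and g :: "'a::real_normed_vector \<Rightarrow> 'b"
  assumes "smooth_on T f" "smooth_on S g" "g ` S \<subseteq> T"
  shows "smooth_on S (\<lambda>x. f (g x))"
proof -
  obtain V F where F: "open V" "T \<subseteq> V" "\<And>k. Ck_on_open k V F" "\<And>x. x \<in> T \<Longrightarrow> F x = f x"
    using assms(1) unfolding smooth_on_def by blast
  obtain U G where G: "open U" "S \<subseteq> U" "\<And>k. Ck_on_open k U G" "\<And>x. x \<in> S \<Longrightarrow> G x = g x"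
    using assms(2) unfolding smooth_on_def by blast
  \<comment> \<open>Away from \<open>S\<close> the extension \<open>G\<close> may leave the domain
    of \<open>F\<close>; the neighbourhood is shrunk to the points that \<open>G\<close> sends into
    \<open>V\<close>.\<close>
  let ?W = "U \<inter> G -` V"
  have "continuous_on U G" using G(3)[of 0] by simp
  then have W: "open ?W" using G(1) F(1) by (rule continuous_open_preimage)
  have "Ck_on_open k ?W (\<lambda>x. F (G x))" for k
    by (rule Ck_on_open_compose[OF W F(1) _ F(3) Ck_on_open_subset[OF G(3)]]) blast+
  moreover have "S \<subseteq> ?W" using F(2) G(2,4) assms(3) by (simp add: subset_iff image_subset_iff)
  moreover have "F (G x) = f (g x)" if "x \<in> S" for x
    using F(4) G(4) assms(3) that by (simp add: image_subset_iff)
  ultimately show ?thesis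
    unfolding smooth_on_def using W by blast
qed

lemma smooth_on_has_derivative:
  assumes "open S" "smooth_on S f" "x \<in> S"
  shows "(f has_derivative frechet_derivative f (at x)) (at x)"
proof -
  have "Ck_on_open (Suc 0) S f" using assms(2) smooth_on_open_iff[OF assms(1)] by blast
  then show ?thesis using assms(3) by (simp add: frechet_derivative_works)
qed

lemma smooth_on_frechet_derivative:
  assumes "open S" "smooth_on S f"
  shows "smooth_on S (\<lambda>x. frechet_derivative f (at x) v)"
  unfolding smooth_on_open_iff[OF assms(1)]
proof
  fix k
  have "Ck_on_open (Suc k) S f" using assms(2) smooth_on_open_iff[OF assms(1)] by blast
  then show "Ck_on_open k S (\<lambda>x. frechet_derivative f (at x) v)" by simp
qed

lemma smooth_on_real_polynomial_function: "real_polynomial_function p \<Longrightarrow> smooth_on S p"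
  by (induction rule: real_polynomial_function.induct)
     (auto intro: smooth_on_linear smooth_on_const smooth_on_add smooth_on_mult)

lemma has_derivative_imp_has_vector_derivative:
  assumes "(f has_derivative D) (at t within S)"
  shows "(f has_vector_derivative D 1) (at t within S)"
proof -
  have "D h = h *\<^sub>R D 1" for h
    using linear_scale[OF has_derivative_linear[OF assms], of h 1] by simp
  then have "D = (\<lambda>h. h *\<^sub>R D 1)" by blast
  then show ?thesis using assms unfolding has_vector_derivative_def by simp
qed

lemma vector_derivative_within_Icc:
  assumes "a < b" "t \<in> {a..b}" "(f has_vector_derivative f') (at t within {a..b})"
  shows "vector_derivative f (at t within {a..b}) = f'"
  using vector_derivative_within_cbox[of a b t f f'] assms unfolding box_real by blast

text \<open>At every point of the interval the one-sided derivative equals the two-sided derivative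
  of a smooth extension in direction 1, and the latter is smooth on an open set.\<close>

lemma smooth_on_Icc_vector_derivative:
  fixes f :: "real \<Rightarrow> 'a::real_normed_vector"
  assumes "a < b" "smooth_on {a..b} f"
  shows "smooth_on {a..b} (\<lambda>t. vector_derivative f (at t within {a..b}))"
    and "t \<in> {a..b} \<Longrightarrow>
      (f has_vector_derivative vector_derivative f (at t within {a..b})) (at t within {a..b})"
proof -
  obtain U F where F: "open U" "{a..b} \<subseteq> U" "smooth_on U F" "\<And>x. x \<in> {a..b} \<Longrightarrow> F x = f x"
    using smooth_on_extension[OF assms(2)] by blast
  have D: "(f has_vector_derivative frechet_derivative F (at t) 1) (at t within {a..b})"
    if t: "t \<in> {a..b}" for t
  proof -
    have "(F has_derivative frechet_derivative F (at t)) (at t)"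
      using F t by (intro smooth_on_has_derivative[of U]) auto
    then have "(F has_vector_derivative frechet_derivative F (at t) 1) (at t)"
      by (rule has_derivative_imp_has_vector_derivative)
    then show ?thesis
      by (intro has_vector_derivative_transform[OF t _ has_vector_derivative_at_within])
         (simp_all add: F(4))
  qed
  note E = vector_derivative_within_Icc[OF assms(1) _ D]
  show "t \<in> {a..b} \<Longrightarrow>
      (f has_vector_derivative vector_derivative f (at t within {a..b})) (at t within {a..b})"
    using D E by simp
  have "smooth_on {a..b} (\<lambda>t. frechet_derivative F (at t) 1)"
    by (rule smooth_on_subset[OF smooth_on_frechet_derivative]) (use F in auto)
  then show "smooth_on {a..b} (\<lambda>t. vector_derivative f (at t within {a..b}))"
    by (rule smooth_on_cong) (simp add: E)
qed

section \<open>Partial derivatives on a rectangle\<close>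

definition partial_fst :: "real \<Rightarrow> real \<Rightarrow> (real \<Rightarrow> real \<Rightarrow> 'a::real_normed_vector) \<Rightarrow> real \<Rightarrow> real \<Rightarrow> 'a"
  where "partial_fst c d f s t = vector_derivative (\<lambda>r. f r t) (at s within {c..d})"

definition partial_snd :: "real \<Rightarrow> real \<Rightarrow> (real \<Rightarrow> real \<Rightarrow> 'a::real_normed_vector) \<Rightarrow> real \<Rightarrow> real \<Rightarrow> 'a"
  where "partial_snd a b f s t = vector_derivative (f s) (at t within {a..b})"

lemma has_vector_derivative_compose_has_derivative:
  assumes "(f has_vector_derivative f') (at x within S)" "(g has_derivative g') (at (f x))"
  shows "((\<lambda>x. g (f x)) has_vector_derivative g' f') (at x within S)"
  using vector_derivative_diff_chain_within[OF assms(1) has_derivative_at_withinI[OF assms(2)]]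
  by (simp add: o_def)

text \<open>Both partials are values of the total derivative of one smooth extension, in the
  directions \<open>(1, 0)\<close> and \<open>(0, 1)\<close>; they are therefore smooth on the
  rectangle, edges included.\<close>

lemma smooth_on_partials:
  fixes f :: "real \<Rightarrow> real \<Rightarrow> 'a::real_normed_vector"
  assumes "c < d" "a < b" and f: "smooth_on ({c..d} \<times> {a..b}) (\<lambda>(s, t). f s t)"
  shows smooth_on_partial_fst: "smooth_on ({c..d} \<times> {a..b}) (\<lambda>(s, t). partial_fst c d f s t)"
    and smooth_on_partial_snd: "smooth_on ({c..d} \<times> {a..b}) (\<lambda>(s, t). partial_snd a b f s t)"
    and has_vector_derivative_partial_fst: "\<lbrakk>s \<in> {c..d}; t \<in> {a..b}\<rbrakk> \<Longrightarrow>
      ((\<lambda>r. f r t) has_vector_derivative partial_fst c d f s t) (at s within {c..d})"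
    and has_vector_derivative_partial_snd: "\<lbrakk>s \<in> {c..d}; t \<in> {a..b}\<rbrakk> \<Longrightarrow>
      (f s has_vector_derivative partial_snd a b f s t) (at t within {a..b})"
proof -
  obtain U F where F: "open U" "{c..d} \<times> {a..b} \<subseteq> U" "smooth_on U F"
    and eq: "\<And>p. p \<in> {c..d} \<times> {a..b} \<Longrightarrow> F p = (\<lambda>(s, t). f s t) p"
    using smooth_on_extension[OF f] by blast
  let ?D = "\<lambda>s t. frechet_derivative F (at (s, t))"
  have D: "(F has_derivative ?D s t) (at (s, t))" if "s \<in> {c..d}" "t \<in> {a..b}" for s t
    using F that by (intro smooth_on_has_derivative[of U]) auto
  have D1: "((\<lambda>r. f r t) has_vector_derivative ?D s t (1, 0)) (at s within {c..d})"
    if st: "s \<in> {c..d}" "t \<in> {a..b}" for s t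
  proof -
    have "((\<lambda>r. (r, t)) has_vector_derivative (1, 0)) (at s within {c..d})"
      by (auto intro!: derivative_eq_intros)
    then have "((\<lambda>r. F (r, t)) has_vector_derivative ?D s t (1, 0)) (at s within {c..d})"
      by (rule has_vector_derivative_compose_has_derivative) (rule D[OF st])
    then show ?thesis
      by (rule has_vector_derivative_transform[OF st(1), rotated]) (use eq st in auto)
  qed
  have D2: "(f s has_vector_derivative ?D s t (0, 1)) (at t within {a..b})"
    if st: "s \<in> {c..d}" "t \<in> {a..b}" for s t
  proof -
    have "((\<lambda>r. (s, r)) has_vector_derivative (0, 1)) (at t within {a..b})"
      by (auto intro!: derivative_eq_intros)
    then have "((\<lambda>r. F (s, r)) has_vector_derivative ?D s t (0, 1)) (at t within {a..b})"
      by (rule has_vector_derivative_compose_has_derivative) (rule D[OF st])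
    then show ?thesis
      by (rule has_vector_derivative_transform[OF st(2), rotated]) (use eq st in auto)
  qed
  have E: "partial_fst c d f s t = ?D s t (1, 0)" "partial_snd a b f s t = ?D s t (0, 1)"
    if "s \<in> {c..d}" "t \<in> {a..b}" for s t
    unfolding partial_fst_def partial_snd_def
    using vector_derivative_within_Icc[OF assms(1) that(1) D1[OF that]]
      vector_derivative_within_Icc[OF assms(2) that(2) D2[OF that]] by simp_all
  show "\<lbrakk>s \<in> {c..d}; t \<in> {a..b}\<rbrakk> \<Longrightarrow>
      ((\<lambda>r. f r t) has_vector_derivative partial_fst c d f s t) (at s within {c..d})"
    and "\<lbrakk>s \<in> {c..d}; t \<in> {a..b}\<rbrakk> \<Longrightarrow>
      (f s has_vector_derivative partial_snd a b f s t) (at t within {a..b})"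
    by (simp_all add: E D1 D2)
  have S: "smooth_on ({c..d} \<times> {a..b}) (\<lambda>p. frechet_derivative F (at p) v)" for v
    by (rule smooth_on_subset[OF smooth_on_frechet_derivative]) (use F in auto)
  show "smooth_on ({c..d} \<times> {a..b}) (\<lambda>(s, t). partial_fst c d f s t)"
    by (rule smooth_on_cong[OF S[of "(1, 0)"]]) (clarsimp simp: E)
  show "smooth_on ({c..d} \<times> {a..b}) (\<lambda>(s, t). partial_snd a b f s t)"
    by (rule smooth_on_cong[OF S[of "(0, 1)"]]) (clarsimp simp: E)
qed

lemma smooth_on_slice:
  fixes f :: "'a::euclidean_space \<Rightarrow> 'b::euclidean_space \<Rightarrow> 'c::real_normed_vector"
  assumes "smooth_on (S \<times> T) (\<lambda>(s, t). f s t)" "s \<in> S"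
  shows "smooth_on T (f s)"
proof -
  have "smooth_on T (\<lambda>t. (\<lambda>(s, t). f s t) (s, t))"
    by (rule smooth_on_compose[OF assms(1) smooth_on_Pair[OF smooth_on_const smooth_on_linear[OF bounded_linear_ident]]])
       (use assms(2) in auto)
  then show ?thesis by simp
qed

text \<open>Differentiation under the integral sign. The upper limit \<open>t\<close> is kept free
  for the symmetry of mixed partials; the first variation takes \<open>t = b\<close>.\<close>

lemma integral_has_vector_derivative_parameter:
  fixes f :: "real \<Rightarrow> real \<Rightarrow> 'a::banach"
  assumes "c < d" "a < b" "smooth_on ({c..d} \<times> {a..b}) (\<lambda>(s, t). f s t)" "s \<in> {c..d}" "t \<in> {a..b}"
  shows "((\<lambda>s. integral {a..t} (f s)) has_vector_derivative integral {a..t} (partial_fst c d f s))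
    (at s within {c..d})"
proof -
  have sub: "{c..d} \<times> cbox a t \<subseteq> {c..d} \<times> {a..b}" using assms(5) by auto
  have int: "f r integrable_on cbox a t" if "r \<in> {c..d}" for r
  proof (rule integrable_continuous)
    show "continuous_on (cbox a t) (f r)"
      by (rule continuous_on_subset[OF smooth_on_continuous_on[OF smooth_on_slice[OF assms(3) that]]])
         (use assms(5) in auto)
  qed
  have cont: "continuous_on ({c..d} \<times> cbox a t) (\<lambda>(s, t). partial_fst c d f s t)"
    by (rule continuous_on_subset[OF
          smooth_on_continuous_on[OF smooth_on_partial_fst[OF assms(1-3)]] sub])
  have der: "((\<lambda>r. f r \<tau>) has_vector_derivative partial_fst c d f r \<tau>) (at r within {c..d})"
    if "r \<in> {c..d}" "\<tau> \<in> cbox a t" for r \<tau>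
    by (rule has_vector_derivative_partial_fst[OF assms(1-3) that(1)]) (use that(2) assms(5) in auto)
  have "((\<lambda>s. integral (cbox a t) (f s)) has_vector_derivative
      integral (cbox a t) (partial_fst c d f s)) (at s within {c..d})"
    by (rule leibniz_rule_vector_derivative[OF der int cont assms(4) convex_real_interval(5)])
  then show ?thesis by simp
qed

text \<open>
  Symmetry of the mixed partial derivatives: differentiate
  \<open>f s t = f s a + \<integral>\<^sub>a\<^sup>t \<partial>\<^sub>t f s \<tau> d\<tau>\<close> under the integral sign.
\<close>

lemma partial_fst_has_vector_derivative:
  fixes f :: "real \<Rightarrow> real \<Rightarrow> 'a::banach"
  assumes "c < d" "a < b" and f: "smooth_on ({c..d} \<times> {a..b}) (\<lambda>(s, t). f s t)"
    and s: "s \<in> {c..d}" and t: "t \<in> {a..b}"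
  shows "((\<lambda>t. partial_fst c d f s t) has_vector_derivative
    partial_fst c d (partial_snd a b f) s t) (at t within {a..b})"
proof -
  note f2 = smooth_on_partial_snd[OF assms(1,2) f]
  let ?h = "\<lambda>t. partial_fst c d f s a + integral {a..t} (partial_fst c d (partial_snd a b f) s)"
  have h_eq: "partial_fst c d f s \<tau> = ?h \<tau>" if \<tau>: "\<tau> \<in> {a..b}" for \<tau>
  proof -
    have eq: "f r \<tau> = f r a + integral {a..\<tau>} (partial_snd a b f r)" if r: "r \<in> {c..d}" for r
    proof -
      have "(partial_snd a b f r has_integral f r \<tau> - f r a) {a..\<tau>}"
        using \<tau>
        by (intro fundamental_theorem_of_calculus has_vector_derivative_within_subset[OF
              has_vector_derivative_partial_snd[OF assms(1,2) f r]]) auto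
      then show ?thesis by (simp add: integral_unique)
    qed
    have *: "((\<lambda>r. f r a + integral {a..\<tau>} (partial_snd a b f r)) has_vector_derivative ?h \<tau>)
        (at s within {c..d})"
      using assms(2)
      by (intro has_vector_derivative_add
          integral_has_vector_derivative_parameter[OF assms(1,2) f2 s \<tau>]
          has_vector_derivative_partial_fst[OF assms(1,2) f s]) simp
    have "((\<lambda>r. f r \<tau>) has_vector_derivative ?h \<tau>) (at s within {c..d})"
      by (rule has_vector_derivative_transform[OF s _ *]) (rule eq)
    from vector_derivative_within_Icc[OF assms(1) s this] show ?thesis
      unfolding partial_fst_def[of c d f s \<tau>] .
  qed
  have "continuous_on {a..b} (partial_fst c d (partial_snd a b f) s)"
    using smooth_on_continuous_on[OF smooth_on_slice[OF smooth_on_partial_fst[OF assms(1,2) f2] s]] .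
  \<comment> \<open>The first summand of \<open>?h\<close> is constant in time; the second is an
    integral with continuous integrand, so its derivative is the integrand.\<close>
  then have *: "(?h has_vector_derivative 0 + partial_fst c d (partial_snd a b f) s t) (at t within {a..b})"
    by (intro has_vector_derivative_add has_vector_derivative_const integral_has_vector_derivative t)
  have "(partial_fst c d f s has_vector_derivative
      0 + partial_fst c d (partial_snd a b f) s t) (at t within {a..b})"
    by (rule has_vector_derivative_transform[OF t _ *]) (rule h_eq)
  then show ?thesis by simp
qed


section \<open>The Euler-Lagrange equations\<close>

text \<open>
  Polynomials serve as test functions: by the Weierstrass theorem \<open>p\<close> may be taken arbitrarily
  close to \<open>f\<close> itself.
\<close>

lemma fundamental_lemma_polynomial:
  fixes f :: "real \<Rightarrow> real"
  assumes "a < b" and f: "continuous_on {a..b} f"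
    and null: "\<And>p. real_polynomial_function p \<Longrightarrow>
      integral {a..b} (\<lambda>t. f t * ((t - a) * (b - t) * p t)) = 0"
    and t: "t \<in> {a..b}"
  shows "f t = 0"
proof -
  \<comment> \<open>The weight vanishes at both ends, which makes the test functions admissible for
    fixed endpoints, and is positive in between.\<close>
  define w where "w t = (t - a) * (b - t)" for t
  have w: "continuous_on {a..b} w" unfolding w_def by (intro continuous_intros)
  define J where "J = integral {a..b} (\<lambda>t. f t * w t * f t)"
  have "compact ((\<lambda>t. f t * w t) ` {a..b})"
    by (intro compact_continuous_image continuous_on_mult f w compact_Icc)
  then obtain B where B: "0 < B" "\<And>t. t \<in> {a..b} \<Longrightarrow> \<bar>f t * w t\<bar> \<le> B"
    using compact_imp_bounded bounded_pos[of "(\<lambda>t. f t * w t) ` {a..b}"] by auto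
  have J_le: "J \<le> e * B * (b - a)" if e: "0 < e" for e
  proof -
    obtain p where p: "real_polynomial_function p" "\<And>t. t \<in> {a..b} \<Longrightarrow> \<bar>f t - p t\<bar> < e"
      using Stone_Weierstrass_real_polynomial_function[OF compact_Icc f e] by blast
    have cp: "continuous_on {a..b} p" using p(1)
      by (intro smooth_on_continuous_on smooth_on_real_polynomial_function)
    \<comment> \<open>The subtracted integral is zero by hypothesis, so \<open>J\<close> is
      controlled by the uniform distance from \<open>f\<close> to \<open>p\<close>.\<close>
    have "J = integral {a..b} (\<lambda>t. f t * w t * f t) - integral {a..b} (\<lambda>t. f t * w t * p t)"
      using null[OF p(1)] unfolding J_def w_def by (simp add: mult.assoc)
    also have "\<dots> = integral {a..b} (\<lambda>t. f t * w t * f t - f t * w t * p t)"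
      by (intro integral_diff[symmetric] integrable_continuous_real continuous_on_mult f w cp)
    also have "\<dots> = integral {a..b} (\<lambda>t. f t * w t * (f t - p t))"
      by (simp only: right_diff_distrib)
    also have "\<dots> \<le> norm \<dots>" by simp
    also have "\<dots> \<le> B * e * (b - a)"
    proof (rule integral_bound)
      fix t assume t: "t \<in> {a..b}"
      show "norm (f t * w t * (f t - p t)) \<le> B * e"
        using mult_mono[OF B(2)[OF t] less_imp_le[OF p(2)[OF t]]] B(1) by (simp add: abs_mult)
    qed (use \<open>a < b\<close> in \<open>simp_all add: continuous_on_mult continuous_on_diff f w cp\<close>)
    finally show ?thesis by (simp add: mult.commute)
  qed
  have "J \<le> 0"
  proof (rule ccontr)
    assume "\<not> J \<le> 0"
    \<comment> \<open>The tolerance is chosen so that the bound becomes \<open>J / 2\<close>,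
      impossible for positive \<open>J\<close>.\<close>
    then have "J \<le> J / (2 * B * (b - a)) * B * (b - a)"
      using B(1) \<open>a < b\<close> by (intro J_le) simp
    then show False using \<open>\<not> J \<le> 0\<close> B(1) \<open>a < b\<close> by (simp add: field_simps)
  qed
  moreover have nonneg: "0 \<le> f t * w t * f t" if "t \<in> {a..b}" for t
  proof -
    have "0 \<le> w t * (f t)\<^sup>2" using that by (simp add: w_def)
    then show ?thesis by (simp only: power2_eq_square mult_ac)
  qed
  have "0 \<le> J" unfolding J_def
    by (intro integral_nonneg integrable_continuous_real continuous_on_mult f w nonneg)
  ultimately have "J = 0" by simp
  moreover have "J = 0 \<longleftrightarrow> (\<forall>t\<in>{a..b}. f t * w t * f t = 0)"
    unfolding J_def
    by (intro integral_eq_0_iff[of a b "\<lambda>t. f t * w t * f t"] continuous_on_mult f w \<open>a < b\<close> nonneg)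
  ultimately have *: "\<forall>t\<in>{a..b}. f t * w t * f t = 0"
    by simp
  \<comment> \<open>Dividing by \<open>w\<close> works only in the interior; continuity supplies the
    endpoints.\<close>
  have "f t = 0" if "t \<in> {a<..<b}" for t
  proof -
    have "w t \<noteq> 0" using that by (simp add: w_def)
    then show ?thesis using bspec[OF *, of t] that by simp
  qed
  moreover have "closure {a<..<b} = {a..b}" using \<open>a < b\<close> by simp
  ultimately show ?thesis
    using continuous_constant_on_closure[of "{a<..<b}" f 0 t] f t by metis
qed

section \<open>First variation of an action with multipliers\<close>

lemma has_vector_derivative_Pair:
  assumes "(f has_vector_derivative f') (at x within S)" "(g has_vector_derivative g') (at x within S)"
  shows "((\<lambda>x. (f x, g x)) has_vector_derivative (f', g')) (at x within S)"
  using has_derivative_Pair[OF assms[unfolded has_vector_derivative_def]]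
  by (simp add: has_vector_derivative_def)

lemma linear_triple_expansion:
  fixes h :: "'a::euclidean_space \<times> 'a \<times> 'b::euclidean_space \<Rightarrow> real"
  assumes "linear h"
  shows "h (x, v, m) = (\<Sum>i\<in>Basis. h (i, 0, 0) * (x \<bullet> i)) + (\<Sum>i\<in>Basis. h (0, i, 0) * (v \<bullet> i))
    + (\<Sum>j\<in>Basis. h (0, 0, j) * (m \<bullet> j))"
proof -
  have "h (x, v, m) = h ((x, 0, 0) + ((0, v, 0) + (0, 0, m)))" by simp
  also have "\<dots> = h (x, 0, 0) + (h (0, v, 0) + h (0, 0, m))"
    by (simp only: linear_add[OF assms])
  finally have split: "h (x, v, m) = h (x, 0, 0) + h (0, v, 0) + h (0, 0, m)" by simp
  have "linear (\<lambda>x. h (x, 0, 0))" "linear (\<lambda>v. h (0, v, 0))" "linear (\<lambda>m. h (0, 0, m))"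
    by (rule linear_compose[OF _ assms, unfolded o_def], rule linearI; simp)+
  note expand = this[THEN linear_Basis_expansion]
  show ?thesis
    unfolding split expand(1)[of x] expand(2)[of v] expand(3)[of m] by (simp add: mult.commute)
qed

text \<open>The argument at which \<open>L\<close> and its derivatives are evaluated along a curve.
  The multiplier enters without its velocity, since the augmented cost does not contain one.\<close>

definition lagrangian_jet :: "real \<Rightarrow> real \<Rightarrow> (real \<Rightarrow> 'a::real_normed_vector) \<Rightarrow> (real \<Rightarrow> 'b) \<Rightarrow> real \<Rightarrow> 'a \<times> 'a \<times> 'b"
  where "lagrangian_jet a b q \<mu> t = (q t, vector_derivative q (at t within {a..b}), \<mu> t)"

definition momentum ::
  "('a::real_normed_vector \<times> 'a \<times> 'b::real_normed_vector \<Rightarrow> real) \<Rightarrow> real \<Rightarrow> real \<Rightarrow> (real \<Rightarrow> 'a) \<Rightarrow> (real \<Rightarrow> 'b) \<Rightarrow> 'a \<Rightarrow> real \<Rightarrow> real"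
  where "momentum L a b q \<mu> i t = frechet_derivative L (at (lagrangian_jet a b q \<mu> t)) (0, i, 0)"

definition euler_lagrange_expr ::
  "('a::real_normed_vector \<times> 'a \<times> 'b::real_normed_vector \<Rightarrow> real) \<Rightarrow> real \<Rightarrow> real \<Rightarrow> (real \<Rightarrow> 'a) \<Rightarrow> (real \<Rightarrow> 'b) \<Rightarrow> 'a \<Rightarrow> real \<Rightarrow> real"
  where "euler_lagrange_expr L a b q \<mu> i t =
    frechet_derivative L (at (lagrangian_jet a b q \<mu> t)) (i, 0, 0)
    - vector_derivative (momentum L a b q \<mu> i) (at t within {a..b})"

text \<open>This is the Euler-Lagrange expression of the multiplier: as no velocity of \<mu> occurs,
  only the partial derivative of \<open>L\<close> remains.\<close>

definition constraint_expr ::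
  "('a::real_normed_vector \<times> 'a \<times> 'b::real_normed_vector \<Rightarrow> real) \<Rightarrow> real \<Rightarrow> real \<Rightarrow> (real \<Rightarrow> 'a) \<Rightarrow> (real \<Rightarrow> 'b) \<Rightarrow> 'b \<Rightarrow> real \<Rightarrow> real"
  where "constraint_expr L a b q \<mu> j t = frechet_derivative L (at (lagrangian_jet a b q \<mu> t)) (0, 0, j)"

lemma smooth_on_lagrangian_jet:
  assumes "a < b" "smooth_on {a..b} q" "smooth_on {a..b} \<mu>"
  shows "smooth_on {a..b} (lagrangian_jet a b q \<mu>)"
  unfolding lagrangian_jet_def
  by (intro smooth_on_Pair smooth_on_Icc_vector_derivative(1) assms)

text \<open>The variational argument is carried out for a general Lagrangian. Openness of
  \<open>D\<close> gives total derivatives of \<open>L\<close> along the curve and room for small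
  variations.\<close>

locale smooth_lagrangian =
  fixes L :: "'a::euclidean_space \<times> 'a \<times> 'b::euclidean_space \<Rightarrow> real" and D :: "'a set"
    and a b :: real and q :: "real \<Rightarrow> 'a" and \<mu> :: "real \<Rightarrow> 'b"
  assumes open_D: "open D" and smooth_L: "smooth_on (D \<times> UNIV) L"
    and ab: "a < b" and smooth_q: "smooth_on {a..b} q" and q_D: "q ` {a..b} \<subseteq> D"
    and smooth_mu: "smooth_on {a..b} \<mu>"
begin

lemma smooth_on_frechet_along:
  "smooth_on {a..b} (\<lambda>t. frechet_derivative L (at (lagrangian_jet a b q \<mu> t)) v)"
proof (rule smooth_on_compose[where f = "\<lambda>z. frechet_derivative L (at z) v" and T = "D \<times> UNIV"])
  show "smooth_on (D \<times> UNIV) (\<lambda>z. frechet_derivative L (at z) v)"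
    by (rule smooth_on_frechet_derivative[OF open_Times[OF open_D open_UNIV] smooth_L])
  show "smooth_on {a..b} (lagrangian_jet a b q \<mu>)"
    by (rule smooth_on_lagrangian_jet[OF ab smooth_q smooth_mu])
  show "lagrangian_jet a b q \<mu> ` {a..b} \<subseteq> D \<times> UNIV"
    using q_D by (auto simp: lagrangian_jet_def)
qed

lemma smooth_on_momentum: "smooth_on {a..b} (momentum L a b q \<mu> i)"
  unfolding momentum_def by (rule smooth_on_frechet_along)

lemma continuous_on_euler_lagrange_expr: "continuous_on {a..b} (euler_lagrange_expr L a b q \<mu> i)"
  unfolding euler_lagrange_expr_def
  by (intro continuous_on_diff smooth_on_continuous_on smooth_on_frechet_along
      smooth_on_Icc_vector_derivative(1)[OF ab smooth_on_momentum])

lemma continuous_on_constraint_expr: "continuous_on {a..b} (constraint_expr L a b q \<mu> j)"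
  unfolding constraint_expr_def by (intro smooth_on_continuous_on smooth_on_frechet_along)

lemma has_derivative_along:
  assumes "t \<in> {a..b}"
  shows "(L has_derivative frechet_derivative L (at (lagrangian_jet a b q \<mu> t)))
    (at (lagrangian_jet a b q \<mu> t))"
  by (rule smooth_on_has_derivative[OF open_Times[OF open_D open_UNIV] smooth_L])
     (use q_D assms in \<open>auto simp: lagrangian_jet_def\<close>)

text \<open>The integrand is differentiated in \<open>s\<close> by the chain rule. Symmetry of mixed
  partials makes the variation of the velocity the time derivative of \<xi>, and integration by
  parts moves that derivative onto the momentum.\<close>

lemma first_variation:
  assumes "0 < \<epsilon>" and V: "fixed_endpoint_variation D \<epsilon> a b q V" and M: "smooth_variation \<epsilon> a b \<mu> M"
  defines "\<xi> \<equiv> partial_fst (-\<epsilon>) \<epsilon> V 0" and "\<nu> \<equiv> partial_fst (-\<epsilon>) \<epsilon> M 0"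
  shows "((\<lambda>s. integral {a..b} (\<lambda>t. L (lagrangian_jet a b (V s) (M s) t))) has_real_derivative
    integral {a..b} (\<lambda>t. (\<Sum>i\<in>Basis. euler_lagrange_expr L a b q \<mu> i t * (\<xi> t \<bullet> i))
      + (\<Sum>j\<in>Basis. constraint_expr L a b q \<mu> j t * (\<nu> t \<bullet> j)))) (at 0)"
proof -
  let ?R = "{-\<epsilon>..\<epsilon>} \<times> {a..b}" and ?P = "momentum L a b q \<mu>"
  let ?P' = "\<lambda>i t. vector_derivative (?P i) (at t within {a..b})"
  have cd: "- \<epsilon> < \<epsilon>" and s0: "0 \<in> {-\<epsilon>..\<epsilon>}" using \<open>0 < \<epsilon>\<close> by auto
  have smV: "smooth_on ?R (\<lambda>(s, t). V s t)" and V0: "\<And>t. t \<in> {a..b} \<Longrightarrow> V 0 t = q t"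
    and VD: "\<And>s t. s \<in> {-\<epsilon>..\<epsilon>} \<Longrightarrow> t \<in> {a..b} \<Longrightarrow> V s t \<in> D"
    and Vab: "\<And>s. s \<in> {-\<epsilon>..\<epsilon>} \<Longrightarrow> V s a = q a" "\<And>s. s \<in> {-\<epsilon>..\<epsilon>} \<Longrightarrow> V s b = q b"
    using V unfolding fixed_endpoint_variation_def smooth_variation_def by auto
  have smM: "smooth_on ?R (\<lambda>(s, t). M s t)" and M0: "\<And>t. t \<in> {a..b} \<Longrightarrow> M 0 t = \<mu> t"
    using M unfolding smooth_variation_def by auto
  \<comment> \<open>The variation of the velocity, with the time derivative taken first. That it is
    the time derivative of \<xi> is shown further down.\<close>
  define \<zeta> where "\<zeta> = partial_fst (-\<epsilon>) \<epsilon> (partial_snd a b V) 0"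
  define f where "f s t = L (V s t, partial_snd a b V s t, M s t)" for s t
  have smVt: "smooth_on ?R (\<lambda>(s, t). partial_snd a b V s t)"
    by (rule smooth_on_partial_snd[OF cd ab smV])
  have smf: "smooth_on ?R (\<lambda>(s, t). f s t)"
  proof -
    have "smooth_on ?R (\<lambda>p. L ((\<lambda>(s, t). V s t) p, (\<lambda>(s, t). partial_snd a b V s t) p, (\<lambda>(s, t). M s t) p))"
      by (rule smooth_on_compose[OF smooth_L smooth_on_Pair[OF smV smooth_on_Pair[OF smVt smM]]])
         (use VD in auto)
    then show ?thesis by (simp add: f_def case_prod_unfold)
  qed
  have jet0: "(V 0 t, partial_snd a b V 0 t, M 0 t) = lagrangian_jet a b q \<mu> t" if t: "t \<in> {a..b}" for t
  proof -
    have "(V 0 has_vector_derivative vector_derivative q (at t within {a..b})) (at t within {a..b})"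
      by (rule has_vector_derivative_transform[OF t _ smooth_on_Icc_vector_derivative(2)[OF ab smooth_q t]])
         (rule V0)
    from vector_derivative_within_Icc[OF ab t this] show ?thesis
      by (simp add: lagrangian_jet_def partial_snd_def V0[OF t] M0[OF t])
  qed
  have f_s: "partial_fst (-\<epsilon>) \<epsilon> f 0 t =
      (\<Sum>i\<in>Basis. frechet_derivative L (at (lagrangian_jet a b q \<mu> t)) (i, 0, 0) * (\<xi> t \<bullet> i))
      + (\<Sum>i\<in>Basis. ?P i t * (\<zeta> t \<bullet> i)) + (\<Sum>j\<in>Basis. constraint_expr L a b q \<mu> j t * (\<nu> t \<bullet> j))"
    if t: "t \<in> {a..b}" for t
  proof -
    note der = has_vector_derivative_partial_fst[OF cd ab _ s0 t]
    have "((\<lambda>s. (V s t, partial_snd a b V s t, M s t)) has_vector_derivative (\<xi> t, \<zeta> t, \<nu> t))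
        (at 0 within {-\<epsilon>..\<epsilon>})"
      unfolding \<xi>_def \<zeta>_def \<nu>_def
      by (rule has_vector_derivative_Pair[OF der[OF smV]
            has_vector_derivative_Pair[OF der[OF smVt] der[OF smM]]])
    then have "((\<lambda>s. f s t) has_vector_derivative
        frechet_derivative L (at (lagrangian_jet a b q \<mu> t)) (\<xi> t, \<zeta> t, \<nu> t)) (at 0 within {-\<epsilon>..\<epsilon>})"
      unfolding f_def
      by (rule has_vector_derivative_compose_has_derivative)
         (simp only: jet0[OF t] has_derivative_along[OF t])
    then have "partial_fst (-\<epsilon>) \<epsilon> f 0 t =
        frechet_derivative L (at (lagrangian_jet a b q \<mu> t)) (\<xi> t, \<zeta> t, \<nu> t)"
      unfolding partial_fst_def by (rule vector_derivative_within_Icc[OF cd s0])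
    from trans[OF this linear_triple_expansion[OF has_derivative_linear[OF has_derivative_along[OF t]]]]
    show ?thesis unfolding momentum_def constraint_expr_def .
  qed
  have "((\<lambda>s. integral {a..b} (f s)) has_vector_derivative
      integral {a..b} (partial_fst (-\<epsilon>) \<epsilon> f 0)) (at 0 within {-\<epsilon>..\<epsilon>})"
    using ab by (intro integral_has_vector_derivative_parameter[OF cd ab smf s0]) simp
  \<comment> \<open>Zero is interior to the parameter interval, so the derivative within it is the
    two-sided one that stationarity asks for.\<close>
  moreover have "at 0 within {-\<epsilon>..\<epsilon>} = at 0"
    using \<open>0 < \<epsilon>\<close> by (intro at_within_Icc_at) auto
  ultimately have deriv: "((\<lambda>s. integral {a..b} (f s)) has_real_derivative
      integral {a..b} (partial_fst (-\<epsilon>) \<epsilon> f 0)) (at 0)"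
    by (simp add: has_real_derivative_iff_has_vector_derivative)
  have f_jet: "f s = (\<lambda>t. L (lagrangian_jet a b (V s) (M s) t))" for s
    by (rule ext) (simp add: f_def lagrangian_jet_def partial_snd_def)
  have \<xi>_deriv: "(\<xi> has_vector_derivative \<zeta> t) (at t within {a..b})" if "t \<in> {a..b}" for t
    unfolding \<xi>_def \<zeta>_def by (rule partial_fst_has_vector_derivative[OF cd ab smV s0 that])
  \<comment> \<open>At the endpoints the variation is constant in \<open>s\<close>; this removes the
    boundary terms.\<close>
  have \<xi>_ends: "\<xi> t = 0" if "t = a \<or> t = b" for t
  proof -
    have "((\<lambda>s. V s t) has_vector_derivative 0) (at 0 within {-\<epsilon>..\<epsilon>})"
      by (rule has_vector_derivative_transform[OF s0 _ has_vector_derivative_const[of "q t"]])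
         (use that Vab in auto)
    then show ?thesis
      unfolding \<xi>_def partial_fst_def by (rule vector_derivative_within_Icc[OF cd s0])
  qed
  have "((\<lambda>t. \<Sum>i\<in>Basis. ?P i t * (\<zeta> t \<bullet> i) + ?P' i t * (\<xi> t \<bullet> i)) has_integral
      (\<Sum>i\<in>Basis. ?P i b * (\<xi> b \<bullet> i)) - (\<Sum>i\<in>Basis. ?P i a * (\<xi> a \<bullet> i))) {a..b}"
  proof (rule fundamental_theorem_of_calculus)
    fix t assume t: "t \<in> {a..b}"
    show "((\<lambda>t. \<Sum>i\<in>Basis. ?P i t * (\<xi> t \<bullet> i)) has_vector_derivative
        (\<Sum>i\<in>Basis. ?P i t * (\<zeta> t \<bullet> i) + ?P' i t * (\<xi> t \<bullet> i))) (at t within {a..b})"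
      by (rule has_vector_derivative_sum, rule has_vector_derivative_mult)
         (rule smooth_on_Icc_vector_derivative(2)[OF ab smooth_on_momentum t]
           bounded_linear.has_vector_derivative[OF bounded_linear_inner_left \<xi>_deriv[OF t]])+
  qed (use ab in simp)
  then have parts: "((\<lambda>t. \<Sum>i\<in>Basis. ?P i t * (\<zeta> t \<bullet> i) + ?P' i t * (\<xi> t \<bullet> i)) has_integral 0) {a..b}"
    by (simp add: \<xi>_ends)
  have "(partial_fst (-\<epsilon>) \<epsilon> f 0 has_integral integral {a..b} (partial_fst (-\<epsilon>) \<epsilon> f 0)) {a..b}"
    by (intro integrable_integral integrable_continuous_real smooth_on_continuous_on
        smooth_on_slice[OF smooth_on_partial_fst[OF cd ab smf] s0])
  \<comment> \<open>Subtracting the vanishing integral of the total derivative of momentum times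
    \<xi> cancels the terms in \<zeta> and leaves the Euler-Lagrange expressions.\<close>
  from has_integral_diff[OF this parts]
  have "((\<lambda>t. partial_fst (-\<epsilon>) \<epsilon> f 0 t - (\<Sum>i\<in>Basis. ?P i t * (\<zeta> t \<bullet> i) + ?P' i t * (\<xi> t \<bullet> i)))
      has_integral integral {a..b} (partial_fst (-\<epsilon>) \<epsilon> f 0)) {a..b}" by simp
  then have "((\<lambda>t. (\<Sum>i\<in>Basis. euler_lagrange_expr L a b q \<mu> i t * (\<xi> t \<bullet> i))
      + (\<Sum>j\<in>Basis. constraint_expr L a b q \<mu> j t * (\<nu> t \<bullet> j)))
      has_integral integral {a..b} (partial_fst (-\<epsilon>) \<epsilon> f 0)) {a..b}"
    by (rule has_integral_eq[rotated])
       (simp add: f_s euler_lagrange_expr_def left_diff_distrib sum.distrib sum_subtractf)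
  with deriv show ?thesis by (simp add: f_jet integral_unique)
qed

end

section \<open>Straight-line polynomial variations as test variations\<close>

lemma smooth_variation_linear:
  fixes c :: "real \<Rightarrow> 'a::euclidean_space"
  assumes "smooth_on {a..b} c" "real_polynomial_function p"
  shows "smooth_variation \<epsilon> a b c (\<lambda>s t. c t + (s * p t) *\<^sub>R e)"
proof -
  let ?R = "{-\<epsilon>..\<epsilon>} \<times> {a..b}"
  have snd: "smooth_on ?R snd" and fst: "smooth_on ?R fst"
    by (rule smooth_on_linear[OF bounded_linear_snd], rule smooth_on_linear[OF bounded_linear_fst])
  have "smooth_on ?R (\<lambda>z. c (snd z))"
    by (rule smooth_on_compose[OF assms(1) snd]) auto
  moreover have "smooth_on ?R (\<lambda>z. p (snd z))"
    by (rule smooth_on_compose[OF smooth_on_real_polynomial_function[OF assms(2)] snd subset_UNIV])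
  ultimately have "smooth_on ?R (\<lambda>z. c (snd z) + (fst z * p (snd z)) *\<^sub>R e)"
    by (intro smooth_on_add smooth_on_scaleR smooth_on_mult smooth_on_const fst)
  then show ?thesis
    unfolding smooth_variation_def by (simp add: case_prod_unfold)
qed

lemma partial_fst_linear:
  assumes "0 < \<epsilon>"
  shows "partial_fst (-\<epsilon>) \<epsilon> (\<lambda>s t. c t + (s * p t) *\<^sub>R e) 0 t = p t *\<^sub>R e"
  unfolding partial_fst_def
proof (rule vector_derivative_within_Icc)
  show "((\<lambda>r. c t + (r * p t) *\<^sub>R e) has_vector_derivative p t *\<^sub>R e) (at 0 within {-\<epsilon>..\<epsilon>})"
    unfolding has_vector_derivative_def
    by (auto intro!: derivative_eq_intros)
qed (use assms in auto)

text \<open>The image of the curve is compact in the open set \<open>D\<close>, so a uniform tube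
  around it lies in \<open>D\<close>, and a bounded displacement stays in the tube for small
  parameters.\<close>

lemma fixed_endpoint_variation_linear:
  fixes q :: "real \<Rightarrow> 'a::euclidean_space"
  assumes "a \<le> b" "open D" "smooth_on {a..b} q" "q ` {a..b} \<subseteq> D"
    and p: "real_polynomial_function p" "p a = 0" "p b = 0"
  obtains \<epsilon> where "0 < \<epsilon>" "fixed_endpoint_variation D \<epsilon> a b q (\<lambda>s t. q t + (s * p t) *\<^sub>R e)"
proof -
  have "compact (q ` {a..b})"
    by (rule compact_continuous_image[OF smooth_on_continuous_on[OF assms(3)] compact_Icc])
  then obtain \<delta> where \<delta>: "0 < \<delta>" "(\<Union>x\<in>q ` {a..b}. ball x \<delta>) \<subseteq> D"
    using compact_subset_open_imp_ball_epsilon_subset assms(2,4) by blast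
  have "compact ((\<lambda>t. p t *\<^sub>R e) ` {a..b})"
    by (rule compact_continuous_image[OF continuous_on_scaleR[OF smooth_on_continuous_on[OF
          smooth_on_real_polynomial_function[OF p(1)]] continuous_on_const] compact_Icc])
  then obtain B where B: "0 < B" "\<And>t. t \<in> {a..b} \<Longrightarrow> norm (p t *\<^sub>R e) \<le> B"
    using compact_imp_bounded bounded_pos[of "(\<lambda>t. p t *\<^sub>R e) ` {a..b}"] by auto
  \<comment> \<open>This keeps the displacement at most \<delta>/2, strictly inside the open
    balls.\<close>
  define \<epsilon> where "\<epsilon> = \<delta> / (2 * B)"
  have "0 < \<epsilon>" using \<delta> B by (simp add: \<epsilon>_def)
  have "q t + (s * p t) *\<^sub>R e \<in> D" if "s \<in> {-\<epsilon>..\<epsilon>}" "t \<in> {a..b}" for s t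
  proof -
    have "norm ((s * p t) *\<^sub>R e) = \<bar>s\<bar> * norm (p t *\<^sub>R e)" by (simp add: abs_mult)
    also have "\<dots> \<le> \<epsilon> * B" using that B by (intro mult_mono) auto
    also have "\<dots> < \<delta>" using \<delta> B by (simp add: \<epsilon>_def)
    finally have "q t + (s * p t) *\<^sub>R e \<in> ball (q t) \<delta>" by (simp add: dist_norm)
    then show ?thesis using \<delta>(2) that(2) by blast
  qed
  then have "fixed_endpoint_variation D \<epsilon> a b q (\<lambda>s t. q t + (s * p t) *\<^sub>R e)"
    unfolding fixed_endpoint_variation_def
    using smooth_variation_linear[OF assms(3) p(1)] p(2,3) by simp
  with \<open>0 < \<epsilon>\<close> show ?thesis by (rule that)
qed

lemma sum_Basis_inner_scaleR:
  fixes e :: "'a::euclidean_space"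
  assumes "e \<in> Basis"
  shows "(\<Sum>i\<in>Basis. f i * ((r *\<^sub>R e) \<bullet> i)) = f e * r"
proof -
  have "(\<Sum>i\<in>Basis. f i * ((r *\<^sub>R e) \<bullet> i)) = (\<Sum>i\<in>Basis. if i = e then f e * r else 0)"
    by (rule sum.cong) (auto simp: inner_Basis assms)
  then show ?thesis using assms by simp
qed

context smooth_lagrangian
begin

text \<open>One direction is immediate from the first variation formula. For the other, variations
  along single basis vectors isolate each component, and the fundamental lemma makes it vanish
  pointwise.\<close>

theorem stationary_iff_euler_lagrange:
  "(\<forall>\<epsilon>>0. \<forall>V M. fixed_endpoint_variation D \<epsilon> a b q V \<longrightarrow> smooth_variation \<epsilon> a b \<mu> M \<longrightarrow>
      ((\<lambda>s. integral {a..b} (\<lambda>t. L (lagrangian_jet a b (V s) (M s) t))) has_real_derivative 0) (at 0))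
    \<longleftrightarrow> (\<forall>t\<in>{a..b}. (\<forall>i\<in>Basis. euler_lagrange_expr L a b q \<mu> i t = 0)
          \<and> (\<forall>j\<in>Basis. constraint_expr L a b q \<mu> j t = 0))"
    (is "?stationary \<longleftrightarrow> ?EL")
proof
  assume EL: ?EL
  show ?stationary
  proof (intro allI impI)
    fix \<epsilon> :: real and V M
    assume *: "0 < \<epsilon>" "fixed_endpoint_variation D \<epsilon> a b q V" "smooth_variation \<epsilon> a b \<mu> M"
    have "integral {a..b} (\<lambda>t. (\<Sum>i\<in>Basis. euler_lagrange_expr L a b q \<mu> i t * (partial_fst (-\<epsilon>) \<epsilon> V 0 t \<bullet> i))
      + (\<Sum>j\<in>Basis. constraint_expr L a b q \<mu> j t * (partial_fst (-\<epsilon>) \<epsilon> M 0 t \<bullet> j)))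
      = integral {a..b} (\<lambda>t. 0)"
      by (rule integral_cong) (use EL in simp)
    then show "((\<lambda>s. integral {a..b} (\<lambda>t. L (lagrangian_jet a b (V s) (M s) t))) has_real_derivative 0) (at 0)"
      using first_variation[OF *] by simp
  qed
next
  assume stationary: ?stationary
  \<comment> \<open>Curve and multiplier are varied together, in directions \<open>e\<close> and
    \<open>e'\<close>; setting either to zero isolates the other. The same weight, vanishing at the
    ends, serves both.\<close>
  have null: "integral {a..b} (\<lambda>t. (\<Sum>i\<in>Basis. euler_lagrange_expr L a b q \<mu> i t * (((t - a) * (b - t) * p t) *\<^sub>R e \<bullet> i))
      + (\<Sum>j\<in>Basis. constraint_expr L a b q \<mu> j t * (((t - a) * (b - t) * p t) *\<^sub>R e' \<bullet> j))) = 0"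
    if p: "real_polynomial_function p" for p e e'
  proof -
    let ?w = "\<lambda>t. (t - a) * (b - t) * p t"
    have lin: "real_polynomial_function (\<lambda>t. t - a)" "real_polynomial_function (\<lambda>t. b - t)"
      by (intro real_polynomial_function_diff real_polynomial_function.intros(2)
          real_polynomial_function.intros(1)[OF bounded_linear_ident])+
    have w: "real_polynomial_function ?w"
      by (intro real_polynomial_function.intros(4) lin p)
    obtain \<epsilon> where \<epsilon>: "0 < \<epsilon>" and V: "fixed_endpoint_variation D \<epsilon> a b q (\<lambda>s t. q t + (s * ?w t) *\<^sub>R e)"
      by (rule fixed_endpoint_variation_linear[OF less_imp_le[OF ab] open_D smooth_q q_D w]) auto
    note M = smooth_variation_linear[OF smooth_mu w, of \<epsilon> e']
    show ?thesis
      using DERIV_unique[OF first_variation[OF \<epsilon> V M] stationary[rule_format, OF \<epsilon> V M]]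
      by (simp only: partial_fst_linear[OF \<epsilon>])
  qed
  have "euler_lagrange_expr L a b q \<mu> e t = 0" if "e \<in> Basis" "t \<in> {a..b}" for e t
  proof (rule fundamental_lemma_polynomial[OF ab continuous_on_euler_lagrange_expr _ that(2)])
    show "integral {a..b} (\<lambda>t. euler_lagrange_expr L a b q \<mu> e t * ((t - a) * (b - t) * p t)) = 0"
      if "real_polynomial_function p" for p
      using null[OF that, of e 0] unfolding sum_Basis_inner_scaleR[OF \<open>e \<in> Basis\<close>] by simp
  qed
  moreover have "constraint_expr L a b q \<mu> e t = 0" if "e \<in> Basis" "t \<in> {a..b}" for e t
  proof (rule fundamental_lemma_polynomial[OF ab continuous_on_constraint_expr _ that(2)])
    show "integral {a..b} (\<lambda>t. constraint_expr L a b q \<mu> e t * ((t - a) * (b - t) * p t)) = 0"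
      if "real_polynomial_function p" for p
      using null[OF that, of 0 e] unfolding sum_Basis_inner_scaleR[OF \<open>e \<in> Basis\<close>] by simp
  qed
  ultimately show ?EL by blast
qed

end

section \<open>Passage to quasi-velocities\<close>

lemma linear_axis_expansion:
  fixes h :: "real^'n::finite \<Rightarrow> 'b::real_vector"
  assumes "linear h"
  shows "h v = (\<Sum>i\<in>UNIV. v $ i *\<^sub>R h (axis i 1))"
proof -
  have "h v = h (\<Sum>i\<in>UNIV. v $ i *\<^sub>R axis i 1)"
    using basis_expansion[of v] by (simp add: scalar_mult_eq_scaleR)
  also have "\<dots> = (\<Sum>i\<in>UNIV. v $ i *\<^sub>R h (axis i 1))"
    by (simp add: linear_sum[OF assms] linear_scale[OF assms])
  finally show ?thesis .
qed

lemma ball_Basis_vec_iff: "(\<forall>i\<in>(Basis :: (real^'n::finite) set). P i) \<longleftrightarrow> (\<forall>i. P (axis i 1))"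
  by (auto simp: Basis_vec_def)

lemma sum_UNIV_sum:
  fixes f :: "'m::finite + 'k::finite \<Rightarrow> 'c::comm_monoid_add"
  shows "(\<Sum>s\<in>UNIV. f s) = (\<Sum>\<sigma>\<in>UNIV. f (Inl \<sigma>)) + (\<Sum>I\<in>UNIV. f (Inr I))"
  using sum.Plus[of "UNIV :: 'm set" "UNIV :: 'k set" f] by (simp add: o_def)

lemma all_sum_type_iff: "(\<forall>s. P s) \<longleftrightarrow> (\<forall>\<sigma>. P (Inl \<sigma>)) \<and> (\<forall>I. P (Inr I))"
  by (metis sumE)

text \<open>\<open>partial_deriv\<close> is defined along a line; differentiability identifies it
  with a value of the total derivative, where the chain rule is available.\<close>

lemma partial_deriv_eq:
  assumes "(f has_derivative f') (at x)"
  shows "partial_deriv f i x = f' (axis i 1)"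
proof -
  have "((\<lambda>h. x + h *\<^sub>R axis i 1) has_vector_derivative axis i 1) (at 0)"
    unfolding has_vector_derivative_def by (auto intro!: derivative_eq_intros)
  then have "((\<lambda>h. f (x + h *\<^sub>R axis i 1)) has_vector_derivative f' (axis i 1)) (at 0)"
    by (rule has_vector_derivative_compose_has_derivative) (simp add: assms)
  then show ?thesis
    unfolding partial_deriv_def by (rule vector_derivative_at)
qed

lemma has_derivative_partial_deriv_expansion:
  assumes "(f has_derivative f') (at x)"
  shows "f' v = (\<Sum>i\<in>UNIV. v $ i *\<^sub>R partial_deriv f i x)"
  unfolding partial_deriv_eq[OF assms]
  by (rule linear_axis_expansion[OF has_derivative_linear[OF assms]])

lemma bounded_bilinear_matrix_vector_mult:
  "bounded_bilinear ((*v) :: real^'n::finite^'m::finite \<Rightarrow> real^'n \<Rightarrow> real^'m)"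
  unfolding bilinear_conv_bounded_bilinear[symmetric] bilinear_def
  by (auto intro!: linearI simp: matrix_vector_right_distrib matrix_vector_mult_add_rdistrib
      scaleR_matrix_vector_assoc matrix_vector_mult_scaleR)

text \<open>Quasi-velocities are written out as \<open>\<Psi> x *v v\<close>, so the Euler-Lagrange
  equations in ordinary velocities apply.\<close>

definition augmented_lagrangian ::
  "(real^('m + 'k) \<Rightarrow> real^('m + 'k)^('m::finite + 'k::finite)) \<Rightarrow>
   (real^('m + 'k) \<Rightarrow> real^('m + 'k) \<Rightarrow> real) \<Rightarrow>
   (real^('m + 'k)) \<times> (real^('m + 'k)) \<times> (real^'m) \<Rightarrow> real" where
  "augmented_lagrangian \<Psi> C = (\<lambda>(x, v, m).
     C x (\<Psi> x *v v) + (\<Sum>\<sigma>\<in>UNIV. m $ \<sigma> * (\<Psi> x *v v) $ Inl \<sigma>))"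

lemma augmented_cost_eq:
  "augmented_cost \<Psi> C a b q \<mu> = integral {a..b} (\<lambda>t. augmented_lagrangian \<Psi> C (lagrangian_jet a b q \<mu> t))"
  unfolding augmented_cost_def augmented_lagrangian_def lagrangian_jet_def quasi_velocity_def by simp

text \<open>
  Contracting the Euler-Lagrange expressions with \<open>\<Phi>\<close> turns them into the Boltzmann-Hamel ones.
  Here \<open>dPsi s i j\<close> stands for \<open>\<partial>\<Psi>\<^sup>s\<^sub>i / \<partial>q\<^sup>j\<close> and \<open>p'\<close> for the time derivative of the
  quasi-momentum \<open>p\<close>.
\<close>

lemma euler_lagrange_contraction:
  fixes Psi Phi :: "real^'n::finite^'n" and v u :: "real^'n" and dC p p' :: "'n \<Rightarrow> real"
    and dPsi :: "'n \<Rightarrow> 'n \<Rightarrow> 'n \<Rightarrow> real"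
  assumes inv: "Psi ** Phi = mat 1" and v: "v = Phi *v u"
  defines "EL \<equiv> \<lambda>i. dC i + (\<Sum>s\<in>UNIV. p s * (\<Sum>l\<in>UNIV. dPsi s l i * v $ l))
    - (\<Sum>s\<in>UNIV. p s * (\<Sum>l\<in>UNIV. dPsi s i l * v $ l) + p' s * Psi $ s $ i)"
  shows "(\<Sum>j\<in>UNIV. Phi $ j $ r * EL j) = (\<Sum>j\<in>UNIV. Phi $ j $ r * dC j)
    + (\<Sum>s\<in>UNIV. \<Sum>k\<in>UNIV. p s * (\<Sum>i\<in>UNIV. \<Sum>j\<in>UNIV.
        (dPsi s i j - dPsi s j i) * Phi $ i $ k * Phi $ j $ r) * u $ k) - p' r"
proof -
  have v_nth: "(\<Sum>k\<in>UNIV. Phi $ i $ k * u $ k) = v $ i" for i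
    by (simp add: v matrix_vector_mult_def)
  have inv_nth: "(\<Sum>j\<in>UNIV. Psi $ s $ j * Phi $ j $ r) = (if s = r then 1 else 0)" for s
    using arg_cong[OF inv, of "\<lambda>A. A $ s $ r"] by (simp add: matrix_matrix_mult_def mat_def)
  \<comment> \<open>The sum over \<open>k\<close> is moved innermost, where \<open>Phi\<close>
    applied to \<open>u\<close> collapses to the velocity \<open>v\<close>.\<close>
  have "(\<Sum>k\<in>UNIV. p s * (\<Sum>i\<in>UNIV. \<Sum>j\<in>UNIV. (dPsi s i j - dPsi s j i) * Phi $ i $ k * Phi $ j $ r) * u $ k)
      = (\<Sum>j\<in>UNIV. Phi $ j $ r * (p s * (\<Sum>l\<in>UNIV. (dPsi s l j - dPsi s j l) * v $ l)))" for s
  proof -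
    have "(\<Sum>k\<in>UNIV. p s * (\<Sum>i\<in>UNIV. \<Sum>j\<in>UNIV. (dPsi s i j - dPsi s j i) * Phi $ i $ k * Phi $ j $ r) * u $ k)
      = (\<Sum>k\<in>UNIV. \<Sum>i\<in>UNIV. \<Sum>j\<in>UNIV. p s * (dPsi s i j - dPsi s j i) * Phi $ j $ r * (Phi $ i $ k * u $ k))"
      by (simp add: sum_distrib_left sum_distrib_right mult_ac)
    also have "\<dots> = (\<Sum>i\<in>UNIV. \<Sum>j\<in>UNIV. \<Sum>k\<in>UNIV. p s * (dPsi s i j - dPsi s j i) * Phi $ j $ r * (Phi $ i $ k * u $ k))"
      by (subst sum.swap, rule sum.cong[OF refl], rule sum.swap)
    also have "\<dots> = (\<Sum>i\<in>UNIV. \<Sum>j\<in>UNIV. p s * (dPsi s i j - dPsi s j i) * Phi $ j $ r * v $ i)"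
      by (simp only: sum_distrib_left[symmetric] v_nth)
    also have "\<dots> = (\<Sum>j\<in>UNIV. \<Sum>i\<in>UNIV. p s * (dPsi s i j - dPsi s j i) * Phi $ j $ r * v $ i)"
      by (rule sum.swap)
    finally show ?thesis by (simp add: sum_distrib_left mult_ac)
  qed
  then have hamel: "(\<Sum>s\<in>UNIV. \<Sum>k\<in>UNIV. p s * (\<Sum>i\<in>UNIV. \<Sum>j\<in>UNIV.
        (dPsi s i j - dPsi s j i) * Phi $ i $ k * Phi $ j $ r) * u $ k)
      = (\<Sum>j\<in>UNIV. \<Sum>s\<in>UNIV. Phi $ j $ r * (p s * (\<Sum>l\<in>UNIV. (dPsi s l j - dPsi s j l) * v $ l)))"
    by (simp only: sum.swap[of "\<lambda>j s. Phi $ j $ r * (p s * (\<Sum>l\<in>UNIV. (dPsi s l j - dPsi s j l) * v $ l))"])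
  \<comment> \<open>Here \<open>Psi ** Phi = mat 1\<close> acts as a Kronecker delta and selects
    \<open>p' r\<close>.\<close>
  have "(\<Sum>j\<in>UNIV. \<Sum>s\<in>UNIV. Phi $ j $ r * (p' s * Psi $ s $ j))
      = (\<Sum>s\<in>UNIV. p' s * (\<Sum>j\<in>UNIV. Psi $ s $ j * Phi $ j $ r))"
    by (subst sum.swap) (simp add: sum_distrib_left mult_ac)
  also have "\<dots> = (\<Sum>s\<in>UNIV. if s = r then p' s else 0)"
    by (rule sum.cong) (simp_all add: inv_nth)
  finally have p': "(\<Sum>j\<in>UNIV. \<Sum>s\<in>UNIV. Phi $ j $ r * (p' s * Psi $ s $ j)) = p' r"
    by simp
  \<comment> \<open>The position derivative of \<open>Psi\<close> and its derivative along the
    motion combine into the antisymmetric difference behind the Hamel coefficients.\<close>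
  have "Phi $ j $ r * EL j = Phi $ j $ r * dC j
      + (\<Sum>s\<in>UNIV. Phi $ j $ r * (p s * (\<Sum>l\<in>UNIV. (dPsi s l j - dPsi s j l) * v $ l)))
      - (\<Sum>s\<in>UNIV. Phi $ j $ r * (p' s * Psi $ s $ j))" for j
    unfolding EL_def sum_distrib_left[of "Phi $ j $ r", symmetric]
    by (simp add: sum.distrib sum_subtractf left_diff_distrib right_diff_distrib distrib_left)
  then show ?thesis
    by (simp only: hamel sum.distrib sum_subtractf p')
qed

text \<open>A further contraction with \<open>Psi\<close> recovers \<open>f\<close>, so no equation
  is lost in passing to the quasi-basis.\<close>

lemma contraction_zero_iff:
  fixes Psi Phi :: "real^'n::finite^'n" and f :: "'n \<Rightarrow> real"
  assumes "Phi ** Psi = mat 1"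
  shows "(\<forall>r. (\<Sum>j\<in>UNIV. Phi $ j $ r * f j) = 0) \<longleftrightarrow> (\<forall>i. f i = 0)"
proof
  assume *: "\<forall>r. (\<Sum>j\<in>UNIV. Phi $ j $ r * f j) = 0"
  show "\<forall>i. f i = 0"
  proof
    fix i
    have Phi_Psi: "(\<Sum>r\<in>UNIV. Phi $ j $ r * Psi $ r $ i) = (if j = i then 1 else 0)" for j
      using arg_cong[OF assms, of "\<lambda>A. A $ j $ i"] by (simp add: matrix_matrix_mult_def mat_def)
    have "(\<Sum>r\<in>UNIV. (\<Sum>j\<in>UNIV. Phi $ j $ r * f j) * Psi $ r $ i)
        = (\<Sum>j\<in>UNIV. f j * (\<Sum>r\<in>UNIV. Phi $ j $ r * Psi $ r $ i))"
      unfolding sum_distrib_left sum_distrib_right by (subst sum.swap) (simp add: mult_ac)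
    also have "\<dots> = (\<Sum>j\<in>UNIV. if j = i then f j else 0)"
      by (rule sum.cong) (simp_all add: Phi_Psi)
    finally show "f i = 0" using * by simp
  qed
qed simp

section \<open>Quasi-momenta and the derivative of the augmented Lagrangian\<close>

locale kinematic_control_problem =
  fixes D :: "(real^('m::finite + 'k::finite)) set"
    and \<Psi> :: "real^('m + 'k) \<Rightarrow> real^('m + 'k)^('m + 'k)"
    and g :: "real^('m + 'k) \<Rightarrow> real^'k \<Rightarrow> real"
    and q :: "real \<Rightarrow> real^('m + 'k)"
    and \<mu> :: "real \<Rightarrow> real^'m"
    and a b :: real
  assumes open_D: "open D" and smooth_Psi: "smooth_on D \<Psi>"
    and invertible_Psi: "\<And>x. x \<in> D \<Longrightarrow> invertible (\<Psi> x)"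
    and smooth_g: "smooth_on (D \<times> UNIV) (\<lambda>(x, w). g x w)"
    and ab: "a < b" and smooth_q: "smooth_on {a..b} q" and q_D: "q ` {a..b} \<subseteq> D"
    and smooth_mu: "smooth_on {a..b} \<mu>"
begin

abbreviation "C \<equiv> cost_of_quasi_velocity g"
abbreviation "L \<equiv> augmented_lagrangian \<Psi> C"
abbreviation "v t \<equiv> vector_derivative q (at t within {a..b})"
abbreviation "u \<equiv> quasi_velocity \<Psi> a b q"
abbreviation "dPsi x s i j \<equiv> partial_deriv (\<lambda>y. \<Psi> y $ s $ i) j x"

text \<open>These are the derivatives of the augmented integrand in the quasi-velocities. The cost
  contributes nothing in constrained directions, so only the multiplier appears there.\<close>

definition quasi_momentum where
  "quasi_momentum x w m s = (case s of Inl \<sigma> \<Rightarrow> m $ \<sigma> | Inr I \<Rightarrow> u_deriv C (Inr I) x w)"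

lemma smooth_C: "smooth_on (D \<times> UNIV) (\<lambda>(x, w). C x w)"
proof -
  have lin: "bounded_linear (\<lambda>w :: real^('m + 'k). \<chi> I. w $ Inr I)"
    unfolding linear_conv_bounded_linear[symmetric] by (rule linearI) (simp_all add: vec_eq_iff)
  have "smooth_on (D \<times> UNIV) (\<lambda>z :: (real^('m + 'k)) \<times> (real^('m + 'k)). (fst z, (\<chi> I. snd z $ Inr I) :: real^'k))"
    by (rule smooth_on_Pair[OF smooth_on_linear[OF bounded_linear_fst]
          smooth_on_linear[OF bounded_linear_compose[OF lin bounded_linear_snd]]])
  note compose = smooth_on_compose[OF smooth_g this]
  have "smooth_on (D \<times> UNIV) (\<lambda>z :: (real^('m + 'k)) \<times> (real^('m + 'k)).
      (\<lambda>(x, w). g x w) (fst z, \<chi> I. snd z $ Inr I))"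
    by (rule compose) auto
  then show ?thesis
    by (simp add: cost_of_quasi_velocity_def case_prod_unfold)
qed

lemma smooth_L: "smooth_on (D \<times> UNIV) L"
proof -
  let ?W = "\<lambda>z :: (real^('m + 'k)) \<times> (real^('m + 'k)) \<times> (real^'m). \<Psi> (fst z) *v fst (snd z)"
  have proj: "smooth_on (D \<times> UNIV) fst" "smooth_on (D \<times> UNIV) (\<lambda>z. fst (snd z))"
    "smooth_on (D \<times> UNIV) (\<lambda>z. snd (snd z))"
    by (rule smooth_on_linear bounded_linear_fst bounded_linear_snd
        bounded_linear_compose[OF bounded_linear_fst bounded_linear_snd]
        bounded_linear_compose[OF bounded_linear_snd bounded_linear_snd])+
  have W: "smooth_on (D \<times> UNIV) ?W"
    by (rule bounded_bilinear.smooth_on[OF bounded_bilinear_matrix_vector_mult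
          smooth_on_compose[OF smooth_Psi proj(1)] proj(2)]) auto
  have "smooth_on (D \<times> UNIV) (\<lambda>z. (\<lambda>(x, w). C x w) (fst z, ?W z))"
    by (rule smooth_on_compose[OF smooth_C smooth_on_Pair[OF proj(1) W]]) auto
  moreover have "smooth_on (D \<times> UNIV) (\<lambda>z. \<Sum>\<sigma>\<in>UNIV. snd (snd z) $ \<sigma> * ?W z $ Inl \<sigma>)"
    by (intro smooth_on_sum finite smooth_on_mult
        smooth_on_linear_compose[OF bounded_linear_vec_nth] proj(3) W)
  ultimately have "smooth_on (D \<times> UNIV)
      (\<lambda>z. (\<lambda>(x, w). C x w) (fst z, ?W z) + (\<Sum>\<sigma>\<in>UNIV. snd (snd z) $ \<sigma> * ?W z $ Inl \<sigma>))"
    by (rule smooth_on_add)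
  then show ?thesis
    by (simp add: augmented_lagrangian_def case_prod_unfold)
qed

sublocale smooth_lagrangian L D a b q \<mu>
  by unfold_locales (fact open_D smooth_L ab smooth_q q_D smooth_mu)+

lemma u_deriv_C_Inl: "u_deriv C (Inl \<sigma>) x w = 0"
proof -
  have "C x (w + h *\<^sub>R axis (Inl \<sigma>) 1) = C x w" for h
    by (simp add: cost_of_quasi_velocity_def axis_def)
  then show ?thesis
    by (simp add: u_deriv_def partial_deriv_def)
qed

text \<open>The total derivative exists by smoothness; linearity splits it into a position and a
  quasi-velocity part, each expanded in the partial derivatives of the statement.\<close>

lemma C_has_derivative:
  assumes "x \<in> D"
  shows "((\<lambda>(x, w). C x w) has_derivative (\<lambda>(\<xi>, \<omega>).
    (\<Sum>i\<in>UNIV. \<xi> $ i * partial_deriv (\<lambda>y. C y w) i x) + (\<Sum>s\<in>UNIV. \<omega> $ s * u_deriv C s x w))) (at (x, w))"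
proof -
  let ?DC = "frechet_derivative (\<lambda>(x, w). C x w) (at (x, w))"
  have D: "((\<lambda>(x, w). C x w) has_derivative ?DC) (at (x, w))"
    by (rule smooth_on_has_derivative[OF open_Times[OF open_D open_UNIV] smooth_C])
       (use assms in simp)
  have "((\<lambda>y. (\<lambda>(x, w). C x w) (y, w)) has_derivative (\<lambda>\<xi>. ?DC (\<xi>, 0))) (at x)"
    by (rule has_derivative_compose[where g = "\<lambda>(x, w). C x w" and g' = ?DC])
       (rule has_derivative_Pair has_derivative_ident has_derivative_const D)+
  then have x: "((\<lambda>y. C y w) has_derivative (\<lambda>\<xi>. ?DC (\<xi>, 0))) (at x)" by simp
  have "((\<lambda>y. (\<lambda>(x, w). C x w) (x, y)) has_derivative (\<lambda>\<omega>. ?DC (0, \<omega>))) (at w)"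
    by (rule has_derivative_compose[where g = "\<lambda>(x, w). C x w" and g' = ?DC])
       (rule has_derivative_Pair has_derivative_ident has_derivative_const D)+
  then have w: "((\<lambda>y. C x y) has_derivative (\<lambda>\<omega>. ?DC (0, \<omega>))) (at w)" by simp
  have "?DC (\<xi>, \<omega>) = (\<Sum>i\<in>UNIV. \<xi> $ i * partial_deriv (\<lambda>y. C y w) i x)
      + (\<Sum>s\<in>UNIV. \<omega> $ s * u_deriv C s x w)" for \<xi> \<omega>
  proof -
    have "?DC (\<xi>, \<omega>) = ?DC ((\<xi>, 0) + (0, \<omega>))" by simp
    also have "\<dots> = ?DC (\<xi>, 0) + ?DC (0, \<omega>)"
      by (rule linear_add[OF has_derivative_linear[OF D]])
    finally show ?thesis
      unfolding has_derivative_partial_deriv_expansion[OF x, of \<xi>]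
        has_derivative_partial_deriv_expansion[OF w, of \<omega>] u_deriv_def by simp
  qed
  then have "?DC = (\<lambda>(\<xi>, \<omega>). (\<Sum>i\<in>UNIV. \<xi> $ i * partial_deriv (\<lambda>y. C y w) i x)
      + (\<Sum>s\<in>UNIV. \<omega> $ s * u_deriv C s x w))" by (simp add: fun_eq_iff)
  with D show ?thesis by metis
qed

lemma Psi_has_derivative:
  assumes "x \<in> D"
  shows "((\<lambda>y. \<Psi> y $ s $ i) has_derivative (\<lambda>\<xi>. frechet_derivative \<Psi> (at x) \<xi> $ s $ i)) (at x)"
  by (intro bounded_linear.has_derivative[OF bounded_linear_vec_nth]
      smooth_on_has_derivative[OF open_D smooth_Psi assms])

text \<open>The chain rule through \<open>\<Psi> x *v y\<close> has two contributions, from the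
  velocity and from the dependence of \<open>\<Psi>\<close> on position. The latter is the source of
  the Hamel coefficients.\<close>

lemma L_has_derivative:
  fixes y :: "real^('m + 'k)" and m :: "real^'m"
  assumes x: "x \<in> D"
  defines "w \<equiv> \<Psi> x *v y"
  shows "(L has_derivative (\<lambda>(\<xi>, \<eta>, \<nu>).
      (\<Sum>i\<in>UNIV. \<xi> $ i * partial_deriv (\<lambda>y. C y w) i x)
      + (\<Sum>s\<in>UNIV. quasi_momentum x w m s * (\<Psi> x *v \<eta> + frechet_derivative \<Psi> (at x) \<xi> *v y) $ s)
      + (\<Sum>\<sigma>\<in>UNIV. \<nu> $ \<sigma> * w $ Inl \<sigma>))) (at (x, y, m))"
proof -
  let ?W = "\<lambda>z :: (real^('m + 'k)) \<times> (real^('m + 'k)) \<times> (real^'m). \<Psi> (fst z) *v fst (snd z)"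
  let ?W' = "\<lambda>z. \<Psi> x *v fst (snd z) + frechet_derivative \<Psi> (at x) (fst z) *v y"
  let ?z = "(x, y, m)"
  have proj: "(fst has_derivative fst) (at ?z)"
    "((\<lambda>z. fst (snd z)) has_derivative (\<lambda>z. fst (snd z))) (at ?z)"
    "((\<lambda>z. snd (snd z)) has_derivative (\<lambda>z. snd (snd z))) (at ?z)"
    by (rule bounded_linear_imp_has_derivative bounded_linear_fst
        bounded_linear_compose[OF bounded_linear_fst bounded_linear_snd]
        bounded_linear_compose[OF bounded_linear_snd bounded_linear_snd])+
  have "((\<lambda>z. \<Psi> (fst z)) has_derivative (\<lambda>z. frechet_derivative \<Psi> (at x) (fst z))) (at ?z)"
    by (rule has_derivative_compose[OF proj(1)]) (simp add: smooth_on_has_derivative[OF open_D smooth_Psi x])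
  from bounded_bilinear.FDERIV[OF bounded_bilinear_matrix_vector_mult this proj(2)]
  have W: "(?W has_derivative ?W') (at ?z)" by simp
  have "((\<lambda>z. (\<lambda>(x, w). C x w) (fst z, ?W z)) has_derivative (\<lambda>z. (\<lambda>(\<xi>, \<omega>).
      (\<Sum>i\<in>UNIV. \<xi> $ i * partial_deriv (\<lambda>y. C y w) i x) + (\<Sum>s\<in>UNIV. \<omega> $ s * u_deriv C s x w))
      (fst z, ?W' z))) (at ?z)"
    by (rule has_derivative_compose[OF has_derivative_Pair[OF proj(1) W]])
       (simp add: C_has_derivative[OF x] w_def)
  moreover have "((\<lambda>z. \<Sum>\<sigma>\<in>UNIV. snd (snd z) $ \<sigma> * ?W z $ Inl \<sigma>) has_derivative
      (\<lambda>z. \<Sum>\<sigma>\<in>UNIV. snd (snd ?z) $ \<sigma> * ?W' z $ Inl \<sigma> + snd (snd z) $ \<sigma> * ?W ?z $ Inl \<sigma>)) (at ?z)"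
    by (intro has_derivative_sum has_derivative_mult
        bounded_linear.has_derivative[OF bounded_linear_vec_nth] proj(3) W)
  ultimately have "(L has_derivative (\<lambda>z. (\<lambda>(\<xi>, \<omega>).
      (\<Sum>i\<in>UNIV. \<xi> $ i * partial_deriv (\<lambda>y. C y w) i x) + (\<Sum>s\<in>UNIV. \<omega> $ s * u_deriv C s x w))
      (fst z, ?W' z) + (\<Sum>\<sigma>\<in>UNIV. snd (snd ?z) $ \<sigma> * ?W' z $ Inl \<sigma> + snd (snd z) $ \<sigma> * ?W ?z $ Inl \<sigma>))) (at ?z)"
    unfolding augmented_lagrangian_def case_prod_unfold by (drule_tac has_derivative_add) simp_all
  then show ?thesis
    \<comment> \<open>After splitting into constrained and unconstrained indices, the cost
      derivatives at \<open>Inl\<close> vanish and the multipliers fill exactly these slots of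
      \<open>quasi_momentum\<close>.\<close>
    by (rule has_derivative_eq_rhs)
       (simp add: fun_eq_iff case_prod_unfold w_def sum_UNIV_sum u_deriv_C_Inl quasi_momentum_def
          sum.distrib mult.commute)
qed

lemma frechet_L:
  fixes y :: "real^('m + 'k)" and m :: "real^'m"
  assumes x: "x \<in> D"
  defines "w \<equiv> \<Psi> x *v y"
  shows "frechet_derivative L (at (x, y, m)) (axis i 1, 0, 0) =
      partial_deriv (\<lambda>y. C y w) i x
      + (\<Sum>s\<in>UNIV. quasi_momentum x w m s * (\<Sum>l\<in>UNIV. dPsi x s l i * y $ l))"
    and "frechet_derivative L (at (x, y, m)) (0, axis i 1, 0) =
      (\<Sum>s\<in>UNIV. quasi_momentum x w m s * \<Psi> x $ s $ i)"
    and "frechet_derivative L (at (x, y, m)) (0, 0, axis \<sigma> 1) = w $ Inl \<sigma>"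
proof -
  note D = frechet_derivative_at[OF L_has_derivative[OF x], symmetric]
  have axis_sum: "(\<Sum>j\<in>UNIV. axis i 1 $ j * f j) = f i" for i :: "'n::finite" and f :: "'n \<Rightarrow> real"
  proof -
    have "(\<Sum>j\<in>UNIV. axis i 1 $ j * f j) = (\<Sum>j\<in>UNIV. if j = i then f j else 0)"
      by (rule sum.cong) (simp_all add: axis_def)
    then show ?thesis by simp
  qed
  have zero: "frechet_derivative \<Psi> (at x) 0 = 0"
    by (rule linear_0[OF has_derivative_linear[OF smooth_on_has_derivative[OF open_D smooth_Psi x]]])
  have "frechet_derivative \<Psi> (at x) (axis i 1) $ s $ l = dPsi x s l i" for s l
    by (rule partial_deriv_eq[OF Psi_has_derivative[OF x], symmetric])
  then have row: "(frechet_derivative \<Psi> (at x) (axis i 1) *v y) $ s = (\<Sum>l\<in>UNIV. dPsi x s l i * y $ l)" for s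
    by (simp add: matrix_vector_mult_def)
  have column: "(\<Psi> x *v axis i 1) $ s = \<Psi> x $ s $ i" for s
    by (simp add: matrix_vector_mult_basis column_def)
  show "frechet_derivative L (at (x, y, m)) (axis i 1, 0, 0) =
      partial_deriv (\<lambda>y. C y w) i x
      + (\<Sum>s\<in>UNIV. quasi_momentum x w m s * (\<Sum>l\<in>UNIV. dPsi x s l i * y $ l))"
    unfolding D w_def by (simp add: axis_sum row)
  show "frechet_derivative L (at (x, y, m)) (0, axis i 1, 0) =
      (\<Sum>s\<in>UNIV. quasi_momentum x w m s * \<Psi> x $ s $ i)"
    unfolding D w_def by (simp add: zero column)
  show "frechet_derivative L (at (x, y, m)) (0, 0, axis \<sigma> 1) = w $ Inl \<sigma>"
    unfolding D w_def by (simp add: axis_sum zero)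
qed

end

section \<open>Boltzmann-Hamel expressions along the curve\<close>

lemma matrix_inv_invertible:
  assumes "invertible A"
  shows "A ** matrix_inv A = mat 1" "matrix_inv A ** A = mat 1"
  using someI_ex[OF assms[unfolded invertible_def]] unfolding matrix_inv_def by blast+

context kinematic_control_problem
begin

definition quasi_momentum_along where
  "quasi_momentum_along s t = quasi_momentum (q t) (u t) (\<mu> t) s"

text \<open>Both sums run over all indices: the constraints are not imposed yet, and multipliers and
  cost derivatives are treated uniformly as quasi-momenta.\<close>

definition boltzmann_hamel_expr where
  "boltzmann_hamel_expr r t = theta_deriv \<Psi> C r (q t) (u t)
    + (\<Sum>s\<in>UNIV. \<Sum>k\<in>UNIV. quasi_momentum_along s t * hamel \<Psi> (q t) s k r * u t $ k)
    - vector_derivative (quasi_momentum_along r) (at t within {a..b})"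

lemma smooth_quasi_velocity: "smooth_on {a..b} u"
  unfolding quasi_velocity_def
  by (rule bounded_bilinear.smooth_on[OF bounded_bilinear_matrix_vector_mult
        smooth_on_compose[OF smooth_Psi smooth_q q_D] smooth_on_Icc_vector_derivative(1)[OF ab smooth_q]])

lemma smooth_u_deriv: "smooth_on {a..b} (\<lambda>t. u_deriv C s (q t) (u t))"
proof -
  let ?C = "\<lambda>(x, w). C x w"
  have "smooth_on {a..b} (\<lambda>t. (\<lambda>z. frechet_derivative ?C (at z) (0, axis s 1)) (q t, u t))"
    by (rule smooth_on_compose[OF smooth_on_frechet_derivative[OF open_Times[OF open_D open_UNIV] smooth_C]
          smooth_on_Pair[OF smooth_q smooth_quasi_velocity]]) (use q_D in auto)
  then show ?thesis
  proof (rule smooth_on_cong)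
    fix t assume "t \<in> {a..b}"
    then have "q t \<in> D" using q_D by auto
    note D = frechet_derivative_at[OF C_has_derivative[OF this], symmetric]
    have "(\<Sum>r\<in>UNIV. axis s 1 $ r * u_deriv C r (q t) (u t))
        = (\<Sum>r\<in>UNIV. if r = s then u_deriv C r (q t) (u t) else 0)"
      by (rule sum.cong) (simp_all add: axis_def)
    then show "frechet_derivative ?C (at (q t, u t)) (0, axis s 1) = u_deriv C s (q t) (u t)"
      unfolding D by simp
  qed
qed

lemma smooth_quasi_momentum_along: "smooth_on {a..b} (quasi_momentum_along s)"
  unfolding quasi_momentum_along_def quasi_momentum_def
  by (cases s) (simp_all add: smooth_u_deriv
      smooth_on_linear_compose[OF bounded_linear_vec_nth smooth_mu])

lemma Psi_along_has_vector_derivative: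
  assumes t: "t \<in> {a..b}"
  shows "((\<lambda>t. \<Psi> (q t) $ s $ i) has_vector_derivative (\<Sum>l\<in>UNIV. dPsi (q t) s i l * v t $ l))
    (at t within {a..b})"
proof -
  have "q t \<in> D" using q_D t by auto
  note D = Psi_has_derivative[OF this, of s i]
  show ?thesis
    using has_vector_derivative_compose_has_derivative[OF smooth_on_Icc_vector_derivative(2)[OF ab smooth_q t] D]
    unfolding has_derivative_partial_deriv_expansion[OF D] by (simp add: mult.commute)
qed

text \<open>The ordinary momentum is the quasi-momentum contracted with \<open>\<Psi>\<close>. The
  product rule for its time derivative puts the Euler-Lagrange expression into the form required by
  \<open>euler_lagrange_contraction\<close>.\<close>

lemma boltzmann_hamel_expr_eq:
  assumes t: "t \<in> {a..b}"
  shows "boltzmann_hamel_expr r t =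
    (\<Sum>j\<in>UNIV. matrix_inv (\<Psi> (q t)) $ j $ r * euler_lagrange_expr L a b q \<mu> (axis j 1) t)"
proof -
  let ?p = "\<lambda>s. quasi_momentum_along s t"
  let ?p' = "\<lambda>s. vector_derivative (quasi_momentum_along s) (at t within {a..b})"
  let ?dC = "\<lambda>i. partial_deriv (\<lambda>y. C y (u t)) i (q t)"
  have qD: "q t \<in> D" if "t \<in> {a..b}" for t using that q_D by auto
  have momentum: "momentum L a b q \<mu> (axis i 1) \<tau> = (\<Sum>s\<in>UNIV. quasi_momentum_along s \<tau> * \<Psi> (q \<tau>) $ s $ i)"
    if "\<tau> \<in> {a..b}" for i \<tau>
    unfolding momentum_def lagrangian_jet_def frechet_L(2)[OF qD[OF that]]
    by (simp add: quasi_momentum_along_def quasi_velocity_def)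
  have *: "((\<lambda>t. \<Sum>s\<in>UNIV. quasi_momentum_along s t * \<Psi> (q t) $ s $ i) has_vector_derivative
      (\<Sum>s\<in>UNIV. ?p s * (\<Sum>l\<in>UNIV. dPsi (q t) s i l * v t $ l) + ?p' s * \<Psi> (q t) $ s $ i))
      (at t within {a..b})" for i
    by (rule has_vector_derivative_sum, rule has_vector_derivative_mult)
       (rule smooth_on_Icc_vector_derivative(2)[OF ab smooth_quasi_momentum_along t]
         Psi_along_has_vector_derivative[OF t])+
  have "(momentum L a b q \<mu> (axis i 1) has_vector_derivative
      (\<Sum>s\<in>UNIV. ?p s * (\<Sum>l\<in>UNIV. dPsi (q t) s i l * v t $ l) + ?p' s * \<Psi> (q t) $ s $ i))
      (at t within {a..b})" for i
    by (rule has_vector_derivative_transform[OF t _ *]) (rule momentum)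
  from vector_derivative_within_Icc[OF ab t this]
  have EL: "euler_lagrange_expr L a b q \<mu> (axis i 1) t = ?dC i
      + (\<Sum>s\<in>UNIV. ?p s * (\<Sum>l\<in>UNIV. dPsi (q t) s l i * v t $ l))
      - (\<Sum>s\<in>UNIV. ?p s * (\<Sum>l\<in>UNIV. dPsi (q t) s i l * v t $ l) + ?p' s * \<Psi> (q t) $ s $ i)" for i
    unfolding euler_lagrange_expr_def lagrangian_jet_def frechet_L(1)[OF qD[OF t]]
    by (simp add: quasi_momentum_along_def quasi_velocity_def)
  have inv: "\<Psi> (q t) ** matrix_inv (\<Psi> (q t)) = mat 1" "matrix_inv (\<Psi> (q t)) ** \<Psi> (q t) = mat 1"
    using matrix_inv_invertible[OF invertible_Psi[OF qD[OF t]]] by blast+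
  have "v t = matrix_inv (\<Psi> (q t)) *v u t"
    by (simp add: quasi_velocity_def matrix_vector_mul_assoc inv)
  from euler_lagrange_contraction[OF inv(1) this, of r ?dC ?p "dPsi (q t)" ?p']
  show ?thesis
    unfolding EL boltzmann_hamel_expr_def theta_deriv_def hamel_def by simp
qed

lemma stationary_iff_boltzmann_hamel:
  "stationary_augmented_cost D \<Psi> C a b q \<mu> \<longleftrightarrow>
    (\<forall>t\<in>{a..b}. (\<forall>r. boltzmann_hamel_expr r t = 0) \<and> (\<forall>\<sigma>. u t $ Inl \<sigma> = 0))"
proof -
  have "(\<forall>i\<in>Basis. euler_lagrange_expr L a b q \<mu> i t = 0) \<longleftrightarrow> (\<forall>r. boltzmann_hamel_expr r t = 0)"
    if t: "t \<in> {a..b}" for t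
  proof -
    have "q t \<in> D" using t q_D by auto
    then have "matrix_inv (\<Psi> (q t)) ** \<Psi> (q t) = mat 1"
      using matrix_inv_invertible[OF invertible_Psi] by blast
    from contraction_zero_iff[OF this] show ?thesis
      unfolding boltzmann_hamel_expr_eq[OF t] ball_Basis_vec_iff by simp
  qed
  moreover have "(\<forall>j\<in>Basis. constraint_expr L a b q \<mu> j t = 0) \<longleftrightarrow> (\<forall>\<sigma>. u t $ Inl \<sigma> = 0)"
    if t: "t \<in> {a..b}" for t
  proof -
    have "q t \<in> D" using t q_D by auto
    from frechet_L(3)[OF this] show ?thesis
      unfolding ball_Basis_vec_iff constraint_expr_def lagrangian_jet_def quasi_velocity_def by simp
  qed
  ultimately show ?thesis
    unfolding stationary_augmented_cost_def augmented_cost_eq stationary_iff_euler_lagrange by simp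
qed

text \<open>The velocity is always the inverse of \<open>\<Psi>\<close> applied to the full
  \<open>u\<close>; by invertibility, dropping the constrained components changes nothing exactly
  when they are zero.\<close>

lemma constraints_iff_velocity:
  assumes t: "t \<in> {a..b}"
  shows "(\<forall>\<sigma>. u t $ Inl \<sigma> = 0) \<longleftrightarrow>
    (\<forall>i. v t $ i = (\<Sum>S\<in>UNIV. matrix_inv (\<Psi> (q t)) $ i $ Inr S * u t $ Inr S))"
    (is "?constraints \<longleftrightarrow> ?velocity")
proof -
  \<comment> \<open>The quasi-velocity with its constrained components replaced by zero.\<close>
  let ?w = "(\<chi> s. case s of Inl \<sigma> \<Rightarrow> 0 | Inr S \<Rightarrow> u t $ Inr S) :: real^('m + 'k)"
  have "q t \<in> D" using t q_D by auto
  then have inv: "\<Psi> (q t) ** matrix_inv (\<Psi> (q t)) = mat 1" "matrix_inv (\<Psi> (q t)) ** \<Psi> (q t) = mat 1"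
    using matrix_inv_invertible[OF invertible_Psi] by blast+
  have "?constraints \<longleftrightarrow> u t = ?w"
    by (simp add: vec_eq_iff all_sum_type_iff)
  also have "\<dots> \<longleftrightarrow> v t = matrix_inv (\<Psi> (q t)) *v ?w"
  proof
    assume "u t = ?w"
    then show "v t = matrix_inv (\<Psi> (q t)) *v ?w"
      by (metis quasi_velocity_def matrix_vector_mul_assoc inv(2) matrix_vector_mul_lid)
  next
    assume "v t = matrix_inv (\<Psi> (q t)) *v ?w"
    then have "\<Psi> (q t) *v v t = ?w"
      by (simp add: matrix_vector_mul_assoc inv)
    then show "u t = ?w" by (simp add: quasi_velocity_def)
  qed
  also have "\<dots> \<longleftrightarrow> ?velocity"
    by (simp add: vec_eq_iff matrix_vector_mult_def sum_UNIV_sum)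
  finally show ?thesis .
qed

section \<open>The equations on curves satisfying the constraints\<close>

lemma vector_derivative_quasi_momentum_along_Inl:
  assumes t: "t \<in> {a..b}"
  shows "vector_derivative (quasi_momentum_along (Inl \<sigma>)) (at t within {a..b})
    = vector_derivative \<mu> (at t within {a..b}) $ \<sigma>"
proof -
  have "quasi_momentum_along (Inl \<sigma>) = (\<lambda>t. \<mu> t $ \<sigma>)"
    by (simp add: quasi_momentum_along_def quasi_momentum_def fun_eq_iff)
  then show ?thesis
    using vector_derivative_within_Icc[OF ab t bounded_linear.has_vector_derivative[OF
        bounded_linear_vec_nth smooth_on_Icc_vector_derivative(2)[OF ab smooth_mu t]]] by simp
qed

text \<open>Vanishing constrained quasi-velocities reduce the sum over \<open>k\<close> to the
  indices \<open>Inr S\<close>; the sum over \<open>s\<close> splits into cost and multiplier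
  terms.\<close>

lemma boltzmann_hamel_expr_constrained:
  assumes "\<forall>\<sigma>. u t $ Inl \<sigma> = 0"
  shows "boltzmann_hamel_expr r t = theta_deriv \<Psi> C r (q t) (u t)
    + (\<Sum>J\<in>UNIV. \<Sum>S\<in>UNIV. u_deriv C (Inr J) (q t) (u t) * hamel \<Psi> (q t) (Inr J) (Inr S) r * u t $ Inr S)
    + (\<Sum>\<tau>\<in>UNIV. \<Sum>S\<in>UNIV. \<mu> t $ \<tau> * hamel \<Psi> (q t) (Inl \<tau>) (Inr S) r * u t $ Inr S)
    - vector_derivative (quasi_momentum_along r) (at t within {a..b})"
  using assms
  by (simp add: boltzmann_hamel_expr_def sum_UNIV_sum quasi_momentum_along_def quasi_momentum_def)

lemma boltzmann_hamel_unconstrained_iff: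
  assumes "\<forall>\<sigma>. u t $ Inl \<sigma> = 0"
  shows "boltzmann_hamel_expr (Inr I) t = 0 \<longleftrightarrow>
    vector_derivative (\<lambda>r. u_deriv C (Inr I) (q r) (u r)) (at t within {a..b})
    - theta_deriv \<Psi> C (Inr I) (q t) (u t)
    - (\<Sum>J\<in>UNIV. \<Sum>S\<in>UNIV. u_deriv C (Inr J) (q t) (u t)
         * hamel \<Psi> (q t) (Inr J) (Inr S) (Inr I) * u t $ Inr S)
    = (\<Sum>\<tau>\<in>UNIV. \<Sum>S\<in>UNIV. \<mu> t $ \<tau>
         * hamel \<Psi> (q t) (Inl \<tau>) (Inr S) (Inr I) * u t $ Inr S)"
proof -
  have "quasi_momentum_along (Inr I) = (\<lambda>r. u_deriv C (Inr I) (q r) (u r))"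
    by (simp add: quasi_momentum_along_def quasi_momentum_def fun_eq_iff)
  then show ?thesis
    unfolding boltzmann_hamel_expr_constrained[OF assms] by auto
qed

lemma boltzmann_hamel_constrained_iff:
  assumes "t \<in> {a..b}" "\<forall>\<sigma>. u t $ Inl \<sigma> = 0"
  shows "boltzmann_hamel_expr (Inl \<sigma>) t = 0 \<longleftrightarrow>
    - theta_deriv \<Psi> C (Inl \<sigma>) (q t) (u t)
    - (\<Sum>J\<in>UNIV. \<Sum>S\<in>UNIV. u_deriv C (Inr J) (q t) (u t)
         * hamel \<Psi> (q t) (Inr J) (Inr S) (Inl \<sigma>) * u t $ Inr S)
    = - (vector_derivative \<mu> (at t within {a..b}) $ \<sigma>)
      + (\<Sum>\<tau>\<in>UNIV. \<Sum>S\<in>UNIV. \<mu> t $ \<tau>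
         * hamel \<Psi> (q t) (Inl \<tau>) (Inr S) (Inl \<sigma>) * u t $ Inr S)"
  unfolding boltzmann_hamel_expr_constrained[OF assms(2)]
    vector_derivative_quasi_momentum_along_Inl[OF assms(1)] by auto

end

theorem theorem3:
  fixes D :: "(real^('m::finite + 'k::finite)) set"
    and \<Psi> :: "real^('m + 'k) \<Rightarrow> real^('m + 'k)^('m + 'k)"
    and \<Phi> :: "real^('m + 'k) \<Rightarrow> real^('m + 'k)^('m + 'k)"
    and g :: "real^('m + 'k) \<Rightarrow> real^'k \<Rightarrow> real"
    and C :: "real^('m + 'k) \<Rightarrow> real^('m + 'k) \<Rightarrow> real"
    and q u :: "real \<Rightarrow> real^('m + 'k)"
    and \<mu> :: "real \<Rightarrow> real^'m"
    and a b :: real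
  assumes "open D"
    and "smooth_on D \<Psi>"
    and "\<And>x. x \<in> D \<Longrightarrow> invertible (\<Psi> x)"
    and "smooth_on (D \<times> UNIV) (\<lambda>(x, w). g x w)"
    and "a < b"
    and "smooth_on {a..b} q"
    and "q ` {a..b} \<subseteq> D"
    and "smooth_on {a..b} \<mu>"
  defines "\<Phi> \<equiv> \<lambda>x. matrix_inv (\<Psi> x)"
    and "C \<equiv> cost_of_quasi_velocity g"
    and "u \<equiv> quasi_velocity \<Psi> a b q"
  shows "stationary_augmented_cost D \<Psi> C a b q \<mu> \<longleftrightarrow>
    (\<forall>t\<in>{a..b}.
      (\<forall>I::'k.
         vector_derivative (\<lambda>r. u_deriv C (Inr I) (q r) (u r)) (at t within {a..b})
         - theta_deriv \<Psi> C (Inr I) (q t) (u t)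
         - (\<Sum>J\<in>UNIV. \<Sum>S\<in>UNIV. u_deriv C (Inr J) (q t) (u t)
              * hamel \<Psi> (q t) (Inr J) (Inr S) (Inr I) * u t $ Inr S)
         = (\<Sum>\<tau>\<in>UNIV. \<Sum>S\<in>UNIV. \<mu> t $ \<tau>
              * hamel \<Psi> (q t) (Inl \<tau>) (Inr S) (Inr I) * u t $ Inr S)) \<and>
      (\<forall>\<sigma>::'m.
         - theta_deriv \<Psi> C (Inl \<sigma>) (q t) (u t)
         - (\<Sum>J\<in>UNIV. \<Sum>S\<in>UNIV. u_deriv C (Inr J) (q t) (u t)
              * hamel \<Psi> (q t) (Inr J) (Inr S) (Inl \<sigma>) * u t $ Inr S)
         = - (vector_derivative \<mu> (at t within {a..b}) $ \<sigma>)
           + (\<Sum>\<tau>\<in>UNIV. \<Sum>S\<in>UNIV. \<mu> t $ \<tau>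
              * hamel \<Psi> (q t) (Inl \<tau>) (Inr S) (Inl \<sigma>) * u t $ Inr S)) \<and>
      (\<forall>i::'m + 'k.
         vector_derivative q (at t within {a..b}) $ i
         = (\<Sum>S\<in>UNIV. \<Phi> (q t) $ i $ Inr S * u t $ Inr S)))"
    (is "_ \<longleftrightarrow> (\<forall>t\<in>{a..b}. ?unconstrained t \<and> ?constrained t \<and> ?velocity t)")
proof -
  interpret kinematic_control_problem D \<Psi> g q \<mu> a b
    by unfold_locales (use assms in auto)
  have "(\<forall>r. boltzmann_hamel_expr r t = 0) \<and> (\<forall>\<sigma>. quasi_velocity \<Psi> a b q t $ Inl \<sigma> = 0) \<longleftrightarrow>
      ?unconstrained t \<and> ?constrained t \<and> ?velocity t" if t: "t \<in> {a..b}" for t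
  \<comment> \<open>The displayed equations sum over unconstrained quasi-velocities only, so they
    are matched with the full expressions under the constraints. If the constraints fail, the
    velocity equation fails too and both sides are false.\<close>
  proof (cases "\<forall>\<sigma>. quasi_velocity \<Psi> a b q t $ Inl \<sigma> = 0")
    case True
    then show ?thesis
      unfolding C_def u_def \<Phi>_def all_sum_type_iff[of "\<lambda>r. boltzmann_hamel_expr r t = 0"]
        boltzmann_hamel_unconstrained_iff[OF True] boltzmann_hamel_constrained_iff[OF t True]
        constraints_iff_velocity[OF t, symmetric] by blast
  next
    case False
    then show ?thesis
      unfolding C_def u_def \<Phi>_def constraints_iff_velocity[OF t, symmetric] by blast
  qed
  then show ?thesis
    unfolding C_def stationary_iff_boltzmann_hamel by (intro ball_cong refl)
qed

end
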